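(* Let $(E,\tau,M,\rho)$ be a Lie algebroid on a smooth manifold $M$. The Lie derivative $\mathcal{L}_\rho$ on $\Omega(M,E)$ has the following properties. 1. For each $V\in A^1(M,E)$ and $f\in C^\infty(M,\mathbb{R})$, $$\mathcal{L}_\rho(V)(d_\rho f)=d_\rho\bigl(\mathcal{L}_\rho(V)f\bigr).$$ 2. For each $V,W\in A^1(M,E)$ and $\eta\in\Omega(M,E)$, $$i\bigl(\{V,W\}\bigr)\eta=\bigl(\mathcal{L}_\rho(V)\circ i(W)-i(W)\circ\mathcal{L}_\rho(V)\bigr)\eta.$$ 3. For each $V\in A^1(M,E)$, $\mathcal{L}_\rho(V)$ is a derivation of degree $0$ of the exterior algebra $\Omega(M,E)$, i.e. for all $\eta,\zeta\in\Omega(M,E)$, $$\mathcal{L}_\rho(V)(\eta\wedge\zeta)=\bigl(\mathcal{L}_\rho(V)\eta\bigr)\wedge\zeta+\eta\wedge\bigl(\mathcal{L}_\rho(V)\zeta\bigr).$$ 4. For each $V,W\in A^1(M,E)$ and $\eta\in\Omega(M,E)$, $$\mathcal{L}_\rho\bigl(\{V,W\}\bigr)\eta=\bigl(\mathcal{L}_\rho(V)\circ\mathcal{L}_\rho(W)-\mathcal{L}_\rho(W)\circ\mathcal{L}_\rho(V)\bigr)\eta.$$ 5. For each $V\in A^1(M,E)$, $f\in C^\infty(M,\mathbb{R})$ and $\eta\in\Omega(M,E)$, $$\mathcal{L}_\rho(fV)\eta=f\mathcal{L}_\rho(V)\eta+d_\rho f\wedge i(V)\eta.$$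
   Context: A Lie algebroid $(E,\tau,M,\rho)$ is a smooth real vector bundle $(E,\tau,M)$ of finite rank over a smooth manifold $M$ (with projection $\tau:E\to M$), equipped with a Lie algebra bracket $(s_1,s_2)\mapsto\{s_1,s_2\}$ on the space of smooth sections of $\tau$ and a smooth vector bundle map $\rho:E\to TM$ (the anchor), such that $s\mapsto\rho\circ s$ is a Lie algebra homomorphism into the Lie algebra of smooth vector fields on $M$, and $\{s_1,fs_2\}=f\{s_1,s_2\}+\langle df,\rho\circ s_1\rangle s_2$ for all smooth sections $s_1,s_2$ and all $f\in C^\infty(M,\mathbb{R})$. $(E^*,\pi,M)$ is the dual bundle. For $p\in\mathbb{Z}$, $A^p(M,E)$ is the space of smooth sections of $\bigwedge^pE$ and $\Omega^p(M,E)$ the space of smooth sections of $\bigwedge^pE^*$, with degree-$0$ parts equal to $C^\infty(M,\mathbb{R})$ and zero for $p<0$; $A(M,E)=\oplus_pA^p(M,E)$ and $\Omega(M,E)=\oplus_p\Omega^p(M,E)$ are graded algebras for the exterior product. An element of $\Omega^p(M,E)$ is identified with a skew-symmetric $C^\infty(M,\mathbb{R})$-multilinear map $A^1(M,E)^p\to C^\infty(M,\mathbb{R})$; the exterior product of forms of degrees $p,q$ is the sum over $(p,q)$-shuffles $\sigma$ of $\varepsilon(\sigma)\,\xi(V_{\sigma(1)},\ldots,V_{\sigma(p)})\,\eta(V_{\sigma(p+1)},\ldots,V_{\sigma(p+q)})$. For $V\in A^1(M,E)$ and $\eta\in\Omega^p(M,E)$, the interior product is $i(V)\eta=0$ for $p\le0$,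 and $i(V)\eta(V_1,\ldots,V_{p-1})=\eta(V,V_1,\ldots,V_{p-1})$ for $p\geq1$. For $f\in C^\infty(M,\mathbb{R})$, $d_\rho f\in\Omega^1(M,E)$ is defined by $\langle d_\rho f,V\rangle=\langle df,\rho\circ V\rangle$ for all $V\in A^1(M,E)$. For $V\in A^1(M,E)$, the Lie derivative $\mathcal{L}_\rho(V):\Omega(M,E)\to\Omega(M,E)$ is the $\mathbb{R}$-linear, degree $0$ map such that $\mathcal{L}_\rho(V)f=\langle df,\rho\circ V\rangle$ for $f\in C^\infty(M,\mathbb{R})$, and, for $\eta\in\Omega^p(M,E)$ with $p>0$, $(\mathcal{L}_\rho(V)\eta)(V_1,\ldots,V_p)=\mathcal{L}_\rho(V)(\eta(V_1,\ldots,V_p))-\sum_{i=1}^p\eta(V_1,\ldots,\{V,V_i\},\ldots,V_p)$. *)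

theory Defs
  imports "HOL-Analysis.Analysis" "HOL-Combinatorics.Permutations"
begin

section \<open>Smooth functions on open subsets of the space of n-tuples\<close>

text \<open>
  The n-dimensional coordinate space is \<^term>\<open>Euclidean_space n\<close>: the functions
  \<^typ>\<open>nat \<Rightarrow> real\<close> vanishing at all indices \<open>i \<ge> n\<close>, with the product topology.  Unlike a
  Euclidean type class, this covers dimension (and, below, rank) 0.
\<close>

definition partial_deriv :: "nat \<Rightarrow> ((nat \<Rightarrow> real) \<Rightarrow> real) \<Rightarrow> (nat \<Rightarrow> real) \<Rightarrow> real" where
  "partial_deriv i f u = deriv (\<lambda>t. f (u(i := t))) (u i)"

primrec C_k_on :: "nat \<Rightarrow> nat \<Rightarrow> (nat \<Rightarrow> real) set \<Rightarrow> ((nat \<Rightarrow> real) \<Rightarrow> real) \<Rightarrow> bool" where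
  "C_k_on n 0 S f \<longleftrightarrow> continuous_on S f"
| "C_k_on n (Suc k) S f \<longleftrightarrow> continuous_on S f \<and>
     (\<forall>i<n. (\<forall>u\<in>S. (\<lambda>t. f (u(i := t))) differentiable (at (u i))) \<and>
            C_k_on n k S (partial_deriv i f))"

definition C_inf_on :: "nat \<Rightarrow> (nat \<Rightarrow> real) set \<Rightarrow> ((nat \<Rightarrow> real) \<Rightarrow> real) \<Rightarrow> bool" where
  "C_inf_on n S f \<longleftrightarrow> (\<forall>k. C_k_on n k S f)"


section \<open>Smooth manifolds\<close>

text \<open>
  The underlying set of the manifold is the whole type \<open>'m\<close>, whose topology is Hausdorff and
  second countable by type class.  The atlas need not be maximal.
\<close>

type_synonym 'm chart = "'m set \<times> ('m \<Rightarrow> nat \<Rightarrow> real)"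

record 'm manifold =
  mdim :: nat
  atlas :: "'m chart set"

definition chart_on :: "nat \<Rightarrow> 'm::topological_space set \<Rightarrow> ('m \<Rightarrow> nat \<Rightarrow> real) \<Rightarrow> bool" where
  "chart_on n U \<phi> \<longleftrightarrow> open U \<and> openin (Euclidean_space n) (\<phi> ` U) \<and>
     homeomorphism U (\<phi> ` U) \<phi> (inv_into U \<phi>)"

definition smooth_on :: "'m::topological_space manifold \<Rightarrow> 'm set \<Rightarrow> ('m \<Rightarrow> real) \<Rightarrow> bool" where
  "smooth_on M W f \<longleftrightarrow>
     (\<forall>(U, \<phi>) \<in> atlas M. C_inf_on (mdim M) (\<phi> ` (U \<inter> W)) (f \<circ> inv_into U \<phi>))"

text \<open>
  The last condition says that all transition maps \<open>\<phi> \<circ> \<psi>\<^sup>-\<^sup>1\<close> are smooth,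
  component by component.
\<close>

definition smooth_manifold :: "'m::{t2_space, second_countable_topology} manifold \<Rightarrow> bool" where
  "smooth_manifold M \<longleftrightarrow>
     (\<Union>(U, \<phi>) \<in> atlas M. U) = UNIV \<and>
     (\<forall>(U, \<phi>) \<in> atlas M. chart_on (mdim M) U \<phi>) \<and>
     (\<forall>(U, \<phi>) \<in> atlas M. \<forall>i < mdim M. smooth_on M U (\<lambda>x. \<phi> x i))"

definition smooth_functions :: "'m::topological_space manifold \<Rightarrow> ('m \<Rightarrow> real) set" where
  "smooth_functions M = {f. smooth_on M UNIV f}"


section \<open>Smooth vector bundles\<close>

text \<open>
  A vector bundle is given by its total space, projection, fibrewise linear structure and an
  atlas of local trivialisations.  A trivialisation over \<open>U\<close> is represented by its fibre
  component \<open>h\<close>, i.e. it is \<open>e \<mapsto> (vproj e, h e)\<close>.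
\<close>

record ('m, 'e) vbundle =
  base :: "'m manifold"
  rank :: nat
  total :: "'e set"
  vproj :: "'e \<Rightarrow> 'm"
  vzero :: "'m \<Rightarrow> 'e"
  vadd :: "'e \<Rightarrow> 'e \<Rightarrow> 'e"
  vscale :: "real \<Rightarrow> 'e \<Rightarrow> 'e"
  trivs :: "('m set \<times> ('e \<Rightarrow> nat \<Rightarrow> real)) set"

definition fibre :: "('m, 'e, 'z) vbundle_scheme \<Rightarrow> 'm \<Rightarrow> 'e set" where
  "fibre E x = {e \<in> total E. vproj E e = x}"

definition fibre_linear ::
  "('m, 'e, 'y) vbundle_scheme \<Rightarrow> ('m, 'f, 'z) vbundle_scheme \<Rightarrow> ('e \<Rightarrow> 'f) \<Rightarrow> bool" where
  "fibre_linear E F \<Phi> \<longleftrightarrow>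
     (\<forall>x. \<forall>a \<in> fibre E x. \<Phi> a \<in> fibre F x \<and>
        (\<forall>b \<in> fibre E x. \<Phi> (vadd E a b) = vadd F (\<Phi> a) (\<Phi> b)) \<and>
        (\<forall>c. \<Phi> (vscale E c a) = vscale F c (\<Phi> a)))"

text \<open>
  Entry \<open>(i, j)\<close> at \<open>x\<close> of the matrix of a fibrewise linear map \<open>\<Phi> : E \<rightarrow> F\<close> with respect to
  the local frames given by fibre components \<open>h\<close> of \<open>E\<close> and \<open>k\<close> of \<open>F\<close>.
\<close>

definition frame_matrix ::
  "('m, 'e, 'z) vbundle_scheme \<Rightarrow> ('e \<Rightarrow> nat \<Rightarrow> real) \<Rightarrow> ('f \<Rightarrow> nat \<Rightarrow> real) \<Rightarrow> ('e \<Rightarrow> 'f) \<Rightarrow>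
     nat \<Rightarrow> nat \<Rightarrow> 'm \<Rightarrow> real" where
  "frame_matrix E h k \<Phi> i j x =
     k (\<Phi> (inv_into (fibre E x) h (\<lambda>l. if l = j then 1 else 0))) i"

definition smooth_bundle_map ::
  "('m::topological_space, 'e, 'y) vbundle_scheme \<Rightarrow> ('m, 'f, 'z) vbundle_scheme \<Rightarrow>
     ('e \<Rightarrow> 'f) \<Rightarrow> bool" where
  "smooth_bundle_map E F \<Phi> \<longleftrightarrow> fibre_linear E F \<Phi> \<and>
     (\<forall>(U, h) \<in> trivs E. \<forall>(W, k) \<in> trivs F. \<forall>i < rank F. \<forall>j < rank E.
        smooth_on (base E) (U \<inter> W) (frame_matrix E h k \<Phi> i j))"

text \<open>
  The fibres are vector spaces because each is carried by some \<open>h\<close> bijectively and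
  compatibly with zero, sum and scalar multiples onto the coordinate space.  The last
  condition is smoothness of the transition functions between trivialisations.
\<close>

definition smooth_vbundle ::
  "('m::{t2_space, second_countable_topology}, 'e, 'z) vbundle_scheme \<Rightarrow> bool" where
  "smooth_vbundle E \<longleftrightarrow> smooth_manifold (base E) \<and>
     (\<forall>x. vzero E x \<in> fibre E x) \<and>
     (\<forall>x. \<forall>a \<in> fibre E x. \<forall>b \<in> fibre E x. vadd E a b \<in> fibre E x) \<and>
     (\<forall>x. \<forall>a \<in> fibre E x. \<forall>c. vscale E c a \<in> fibre E x) \<and>
     (\<Union>(U, h) \<in> trivs E. U) = UNIV \<and>
     (\<forall>(U, h) \<in> trivs E. open U \<and>
        (\<forall>x \<in> U. bij_betw h (fibre E x) (topspace (Euclidean_space (rank E))) \<and>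
           h (vzero E x) = (\<lambda>i. 0) \<and>
           (\<forall>a \<in> fibre E x. \<forall>b \<in> fibre E x. h (vadd E a b) = (\<lambda>i. h a i + h b i)) \<and>
           (\<forall>a \<in> fibre E x. \<forall>c. h (vscale E c a) = (\<lambda>i. c * h a i)))) \<and>
     (\<forall>(U, h) \<in> trivs E. \<forall>(W, k) \<in> trivs E. \<forall>i < rank E. \<forall>j < rank E.
        smooth_on (base E) (U \<inter> W) (frame_matrix E h k id i j))"

definition sections ::
  "('m::topological_space, 'e, 'z) vbundle_scheme \<Rightarrow> ('m \<Rightarrow> 'e) set" where
  "sections E = {s. (\<forall>x. s x \<in> fibre E x) \<and>
     (\<forall>(U, h) \<in> trivs E. \<forall>i < rank E. smooth_on (base E) U (\<lambda>x. h (s x) i))}"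

definition sec_add ::
  "('m, 'e, 'z) vbundle_scheme \<Rightarrow> ('m \<Rightarrow> 'e) \<Rightarrow> ('m \<Rightarrow> 'e) \<Rightarrow> 'm \<Rightarrow> 'e" where
  "sec_add E s t = (\<lambda>x. vadd E (s x) (t x))"

definition sec_scale ::
  "('m, 'e, 'z) vbundle_scheme \<Rightarrow> ('m \<Rightarrow> real) \<Rightarrow> ('m \<Rightarrow> 'e) \<Rightarrow> 'm \<Rightarrow> 'e" where
  "sec_scale E f s = (\<lambda>x. vscale E (f x) (s x))"


section \<open>Tangent bundle and vector fields\<close>

text \<open>
  A tangent vector at \<open>x\<close> is represented by its directional derivative, a functional on the
  functions that are smooth near \<open>x\<close> (extended by 0 to all other functions): in a chart it is
  \<open>\<Sum>i. a\<^sub>i \<partial>/\<partial>x\<^sub>i\<close>.  By the chain rule, having this form in one chart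
  around \<open>x\<close> is the same as having it in every chart around \<open>x\<close>.
\<close>

type_synonym 'm tvec = "'m \<times> (('m \<Rightarrow> real) \<Rightarrow> real)"

definition smooth_near :: "'m::topological_space manifold \<Rightarrow> 'm \<Rightarrow> ('m \<Rightarrow> real) set" where
  "smooth_near M x = {f. \<exists>W. open W \<and> x \<in> W \<and> smooth_on M W f}"

definition tangent_space ::
  "'m::topological_space manifold \<Rightarrow> 'm \<Rightarrow> (('m \<Rightarrow> real) \<Rightarrow> real) set" where
  "tangent_space M x = {v. (\<forall>f. f \<notin> smooth_near M x \<longrightarrow> v f = 0) \<and>
     (\<forall>(U, \<phi>) \<in> atlas M. x \<in> U \<longrightarrow>
        (\<exists>a :: nat \<Rightarrow> real. \<forall>f \<in> smooth_near M x.
           v f = (\<Sum>i < mdim M. a i * partial_deriv i (f \<circ> inv_into U \<phi>) (\<phi> x))))}"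

text \<open>
  The trivialisation over a chart domain sends \<open>(x, v)\<close> to the components
  \<open>v (x\<^sub>i)\<close> of \<open>v\<close> in that chart.
\<close>

definition tangent_bundle :: "'m::topological_space manifold \<Rightarrow> ('m, 'm tvec) vbundle" where
  "tangent_bundle M = \<lparr>
     base = M,
     rank = mdim M,
     total = {(x, v). v \<in> tangent_space M x},
     vproj = fst,
     vzero = (\<lambda>x. (x, \<lambda>f. 0)),
     vadd = (\<lambda>a b. (fst a, \<lambda>f. snd a f + snd b f)),
     vscale = (\<lambda>c a. (fst a, \<lambda>f. c * snd a f)),
     trivs = (\<lambda>(U, \<phi>). (U, \<lambda>a i. if i < mdim M then snd a (\<lambda>y. \<phi> y i) else 0)) ` atlas M \<rparr>"

definition d_pair :: "('m \<Rightarrow> real) \<Rightarrow> ('m \<Rightarrow> 'm tvec) \<Rightarrow> 'm \<Rightarrow> real"  (* <df, X> *) where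
  "d_pair f X = (\<lambda>x. snd (X x) f)"

definition vf_bracket ::
  "'m::topological_space manifold \<Rightarrow> ('m \<Rightarrow> 'm tvec) \<Rightarrow> ('m \<Rightarrow> 'm tvec) \<Rightarrow> 'm \<Rightarrow> 'm tvec" where
  "vf_bracket M X Y = (\<lambda>x. (x, \<lambda>f. if f \<in> smooth_near M x
     then d_pair (d_pair f Y) X x - d_pair (d_pair f X) Y x else 0))"


section \<open>Lie algebroids\<close>

record ('m, 'e) algebroid = "('m, 'e) vbundle" +
  bracket :: "('m \<Rightarrow> 'e) \<Rightarrow> ('m \<Rightarrow> 'e) \<Rightarrow> 'm \<Rightarrow> 'e"
  anchor :: "'e \<Rightarrow> 'm tvec"

definition lie_algebra_bracket ::
  "('m::topological_space, 'e, 'z) vbundle_scheme \<Rightarrow>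
     (('m \<Rightarrow> 'e) \<Rightarrow> ('m \<Rightarrow> 'e) \<Rightarrow> 'm \<Rightarrow> 'e) \<Rightarrow> bool" where
  "lie_algebra_bracket E br \<longleftrightarrow>
     (\<forall>s \<in> sections E. \<forall>t \<in> sections E. br s t \<in> sections E) \<and>
     (\<forall>s \<in> sections E. \<forall>t \<in> sections E. \<forall>u \<in> sections E. \<forall>c :: real.
        br (sec_add E s t) u = sec_add E (br s u) (br t u) \<and>
        br u (sec_add E s t) = sec_add E (br u s) (br u t) \<and>
        br (sec_scale E (\<lambda>x. c) s) t = sec_scale E (\<lambda>x. c) (br s t) \<and>
        br s (sec_scale E (\<lambda>x. c) t) = sec_scale E (\<lambda>x. c) (br s t)) \<and>
     (\<forall>s \<in> sections E. br s s = vzero E) \<and>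
     (\<forall>s \<in> sections E. \<forall>t \<in> sections E. \<forall>u \<in> sections E.
        sec_add E (br s (br t u)) (sec_add E (br t (br u s)) (br u (br s t))) = vzero E)"

text \<open>
  Real-linearity of \<open>s \<mapsto> anchor \<circ> s\<close> is part of \<^const>\<open>smooth_bundle_map\<close>.
\<close>

definition lie_algebroid ::
  "('m::{t2_space, second_countable_topology}, 'e) algebroid \<Rightarrow> bool" where
  "lie_algebroid L \<longleftrightarrow> smooth_vbundle L \<and>
     lie_algebra_bracket L (bracket L) \<and>
     smooth_bundle_map L (tangent_bundle (base L)) (anchor L) \<and>
     (\<forall>s \<in> sections L. \<forall>t \<in> sections L.
        anchor L \<circ> bracket L s t = vf_bracket (base L) (anchor L \<circ> s) (anchor L \<circ> t)) \<and>
     (\<forall>s \<in> sections L. \<forall>t \<in> sections L. \<forall>f \<in> smooth_functions (base L).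
        bracket L s (sec_scale L f t) =
          sec_add L (sec_scale L f (bracket L s t)) (sec_scale L (d_pair f (anchor L \<circ> s)) t))"


section \<open>The exterior algebra of forms\<close>

text \<open>
  A form is a function on finite lists of sections: its component of degree \<open>p\<close> is its
  restriction to lists of length \<open>p\<close>, so that a smooth function, regarded as a form of
  degree 0, is the value on the empty list.  Forms are 0 on lists containing
  something that is not a smooth section, which makes equality of forms equality of functions.
  For \<open>p < 0\<close> the space \<open>forms_deg E p\<close> contains only the zero form.
\<close>

type_synonym ('m, 'e) form = "('m \<Rightarrow> 'e) list \<Rightarrow> 'm \<Rightarrow> real"

definition forms_deg ::
  "('m::topological_space, 'e, 'z) vbundle_scheme \<Rightarrow> int \<Rightarrow> ('m, 'e) form set" where
  "forms_deg E p = {\<eta>.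
     (\<forall>vs. \<not> (int (length vs) = p \<and> set vs \<subseteq> sections E) \<longrightarrow> \<eta> vs = (\<lambda>x. 0)) \<and>
     (\<forall>vs. int (length vs) = p \<and> set vs \<subseteq> sections E \<longrightarrow>
        \<eta> vs \<in> smooth_functions (base E) \<and>
        (\<forall>i < length vs. \<forall>s \<in> sections E. \<forall>t \<in> sections E.
           \<eta> (vs[i := sec_add E s t]) = (\<lambda>x. \<eta> (vs[i := s]) x + \<eta> (vs[i := t]) x)) \<and>
        (\<forall>i < length vs. \<forall>s \<in> sections E. \<forall>f \<in> smooth_functions (base E).
           \<eta> (vs[i := sec_scale E f s]) = (\<lambda>x. f x * \<eta> (vs[i := s]) x)) \<and>
        (\<forall>i < length vs. \<forall>j < length vs. i \<noteq> j \<longrightarrow>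
           \<eta> (vs[i := vs ! j, j := vs ! i]) = (\<lambda>x. - \<eta> vs x)))}"

definition forms ::
  "('m::topological_space, 'e, 'z) vbundle_scheme \<Rightarrow> ('m, 'e) form set" where
  "forms E = {\<eta>. \<exists>P \<xi>. finite P \<and> (\<forall>p \<in> P. \<xi> p \<in> forms_deg E p) \<and>
     \<eta> = (\<lambda>vs x. \<Sum>p \<in> P. \<xi> p vs x)}"

definition form_add :: "('m, 'e) form \<Rightarrow> ('m, 'e) form \<Rightarrow> ('m, 'e) form" where
  "form_add \<eta> \<zeta> = (\<lambda>vs x. \<eta> vs x + \<zeta> vs x)"

definition form_diff :: "('m, 'e) form \<Rightarrow> ('m, 'e) form \<Rightarrow> ('m, 'e) form" where
  "form_diff \<eta> \<zeta> = (\<lambda>vs x. \<eta> vs x - \<zeta> vs x)"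

definition form_scale :: "('m \<Rightarrow> real) \<Rightarrow> ('m, 'e) form \<Rightarrow> ('m, 'e) form" where
  "form_scale f \<eta> = (\<lambda>vs x. f x * \<eta> vs x)"

definition fun_form :: "('m \<Rightarrow> real) \<Rightarrow> ('m, 'e) form" where
  "fun_form f = (\<lambda>vs. if vs = [] then f else (\<lambda>x. 0))"

definition perm_shuffles :: "nat \<Rightarrow> nat \<Rightarrow> (nat \<Rightarrow> nat) set" where
  "perm_shuffles p q = {\<sigma>. \<sigma> permutes {..<p + q} \<and>
     strict_mono_on {..<p} \<sigma> \<and> strict_mono_on {p..<p + q} \<sigma>}"

text \<open>
  On a list of length \<open>n\<close>, the terms with \<open>p + q = n\<close> are the products of the degree \<open>p\<close>
  component of \<open>\<xi>\<close> and the degree \<open>q\<close> component of \<open>\<eta>\<close>.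
\<close>

definition wedge :: "('m, 'e) form \<Rightarrow> ('m, 'e) form \<Rightarrow> ('m, 'e) form" where
  "wedge \<xi> \<eta> = (\<lambda>vs x. \<Sum>p \<le> length vs. \<Sum>\<sigma> \<in> perm_shuffles p (length vs - p).
     of_int (sign \<sigma>) * \<xi> (map (\<lambda>i. vs ! \<sigma> i) [0..<p]) x *
       \<eta> (map (\<lambda>i. vs ! \<sigma> i) [p..<length vs]) x)"

definition int_prod :: "('m \<Rightarrow> 'e) \<Rightarrow> ('m, 'e) form \<Rightarrow> ('m, 'e) form" where
  "int_prod V \<eta> = (\<lambda>vs. \<eta> (V # vs))"

definition d_rho :: "('m::topological_space, 'e) algebroid \<Rightarrow> ('m \<Rightarrow> real) \<Rightarrow> ('m, 'e) form" where
  "d_rho L f = (\<lambda>vs. if length vs = 1 \<and> set vs \<subseteq> sections L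
     then d_pair f (anchor L \<circ> hd vs) else (\<lambda>x. 0))"

text \<open>
  On the empty list the formula gives \<open>\<langle>df, \<rho> \<circ> V\<rangle>\<close> where \<open>f\<close> is the degree 0 component.
\<close>

definition lie_deriv ::
  "('m::topological_space, 'e) algebroid \<Rightarrow> ('m \<Rightarrow> 'e) \<Rightarrow> ('m, 'e) form \<Rightarrow> ('m, 'e) form" where
  "lie_deriv L V \<eta> = (\<lambda>vs x. if set vs \<subseteq> sections L
     then d_pair (\<eta> vs) (anchor L \<circ> V) x -
       (\<Sum>i < length vs. \<eta> (vs[i := bracket L V (vs ! i)]) x)
     else 0)"

end

theory Submission
  imports Defs
begin

text \<open>
  Each section \<open>V\<close> acts on smooth functions by \<open>f \<mapsto> \<langle>df, \<rho> \<circ> V\<rangle>\<close>.  In a chart a tangent vector \<open>v\<close> is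
  \<open>\<Sum>i. v (x\<^sub>i) \<partial>/\<partial>x\<^sub>i\<close> (evaluate it on the coordinate functions), so this action is a derivation
  of the smooth functions; it represents the bracket by the anchor axiom.  All five properties then
  follow algebraically from the Leibniz and Jacobi identities by evaluating on a list of sections.
  In the commutator formula the terms with brackets in two different slots cancel by symmetry, and
  the diagonal terms are Jacobi.  In the wedge product rule, a shuffle \<open>\<sigma>\<close> reindexes the slots so
  that each bracket lands in one of the two factors.  In the formula for \<open>f V\<close>, the Leibniz rule leaves
  \<open>\<Sum>i. \<langle>df, \<rho> \<circ> V\<^sub>i\<rangle> \<eta>(V\<^sub>1, \<dots>, V, \<dots>, V\<^sub>p)\<close> with \<open>V\<close> in slot \<open>i\<close>; a \<open>(1, p - 1)\<close>-shuffle is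
  determined by its value \<open>i\<close> at the first index, and skew-symmetry moves \<open>V\<close> from slot \<open>i\<close> to the
  front at the cost of exactly its sign.
\<close>

section \<open>Smooth functions on coordinate spaces and manifolds\<close>

lemma openin_Euclidean_space_iff:
  "openin (Euclidean_space n) S \<longleftrightarrow>
     (\<exists>T. open T \<and> S = T \<inter> {u. \<forall>i\<ge>n. u i = (0::real)})"
  by (simp add: Euclidean_space_def openin_subtopology euclidean_product_topology)

text \<open>Varying a coordinate of index below \<open>n\<close> does not leave the coordinate
  space, so a relatively open set contains a short segment of the coordinate line through each of
  its points. This makes partial derivatives local on sets that are open only in
  \<open>Euclidean_space n\<close>.\<close>

lemma eventually_coordinate_line:
  assumes S: "openin (Euclidean_space n) S" and u: "u \<in> S" and i: "i < n"
  shows "\<forall>\<^sub>F t in nhds (u i). u(i := t) \<in> S"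
proof -
  obtain T where T: "open T" and ST: "S = T \<inter> {u. \<forall>i\<ge>n. u i = 0}"
    using S unfolding openin_Euclidean_space_iff by blast
  have "continuous_on UNIV (\<lambda>t::real. u(i := t))"
  proof (rule continuous_on_coordinatewise_then_product)
    show "continuous_on UNIV (\<lambda>t. (u(i := t)) j)" for j
      by (cases "j = i") (simp_all add: continuous_on_const continuous_on_id)
  qed
  hence "open ((\<lambda>t. u(i := t)) -` T)"
    using T by (simp add: open_vimage)
  moreover have "u i \<in> (\<lambda>t. u(i := t)) -` T"
    using u ST by simp
  ultimately have "\<forall>\<^sub>F t in nhds (u i). u(i := t) \<in> T"
    by (auto simp: eventually_nhds)
  thus ?thesis
    using u i by (auto simp: ST elim!: eventually_mono)
qed

section \<open>Calculus of C^k functions on open subsets of coordinate space\<close>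

lemma C_k_on_subset: "C_k_on n k S f \<Longrightarrow> T \<subseteq> S \<Longrightarrow> C_k_on n k T f"
  by (induction k arbitrary: f) (auto intro: continuous_on_subset)

lemma C_k_on_lower: "C_k_on n (Suc k) S f \<Longrightarrow> C_k_on n k S f"
proof (induction k arbitrary: f)
  case (Suc k)
  hence "\<forall>i<n. C_k_on n k S (partial_deriv i f)" by fastforce
  thus ?case using Suc.prems by (simp del: fun_upd_apply)
qed simp

lemma C_k_on_continuous: "C_k_on n k S f \<Longrightarrow> continuous_on S f"
  by (cases k) auto

lemma partial_deriv_cong:
  assumes "openin (Euclidean_space n) S" "u \<in> S" "i < n" "\<And>w. w \<in> S \<Longrightarrow> f w = g w"
  shows "partial_deriv i f u = partial_deriv i g u"
  unfolding partial_deriv_def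
  by (rule deriv_cong_ev[OF eventually_mono[OF eventually_coordinate_line[OF assms(1-3)]]])
     (auto simp: assms)

lemma differentiable_line_cong:
  fixes f g :: "(nat \<Rightarrow> real) \<Rightarrow> real"
  assumes "openin (Euclidean_space n) S" "u \<in> S" "i < n" "\<And>w. w \<in> S \<Longrightarrow> f w = g w"
    and "(\<lambda>t. f (u(i := t))) differentiable at (u i)"
  shows "(\<lambda>t. g (u(i := t))) differentiable at (u i :: real)"
proof -
  obtain D where D: "((\<lambda>t. f (u(i := t))) has_field_derivative (D::real)) (at (u i))"
    using assms(5) real_differentiable_def by blast
  have "((\<lambda>t. g (u(i := t))) has_field_derivative D) (at (u i))"
    using DERIV_cong_ev[OF refl eventually_mono[OF eventually_coordinate_line[OF assms(1-3)],
            of "\<lambda>t. f (u(i := t)) = g (u(i := t))"] refl] D assms(4) by blast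
  thus ?thesis
    using real_differentiable_def by blast
qed

text \<open>The functions may differ outside \<open>S\<close>, but openness of \<open>S\<close>
  makes their partial derivatives agree at every point of \<open>S\<close>, which is the hypothesis
  needed for the next order of the induction.\<close>

lemma C_k_on_cong:
  assumes S: "openin (Euclidean_space n) S"
  shows "(\<And>u. u \<in> S \<Longrightarrow> f u = g u) \<Longrightarrow> C_k_on n k S f \<Longrightarrow> C_k_on n k S g"
proof (induction k arbitrary: f g)
  case 0
  thus ?case using continuous_on_cong[of S S f g] by simp
next
  case (Suc k)
  have "continuous_on S g"
    using Suc.prems continuous_on_cong[of S S f g] by simp
  moreover have "C_k_on n k S (partial_deriv i g)" if "i < n" for i
  proof (rule Suc.IH)
    show "partial_deriv i f u = partial_deriv i g u" if "u \<in> S" for u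
      by (rule partial_deriv_cong[OF S that \<open>i < n\<close> Suc.prems(1)])
    show "C_k_on n k S (partial_deriv i f)"
      using Suc.prems(2) that by simp
  qed
  moreover have "(\<lambda>t. g (u(i := t))) differentiable at (u i)" if "i < n" "u \<in> S" for i u
  proof (rule differentiable_line_cong[OF S that(2,1) Suc.prems(1)])
    show "(\<lambda>t. f (u(i := t))) differentiable at (u i)"
      using Suc.prems(2) that unfolding C_k_on.simps by blast
  qed
  ultimately show ?case by (simp del: fun_upd_apply)
qed

lemma continuous_on_local:
  fixes f :: "(nat \<Rightarrow> real) \<Rightarrow> real"
  assumes "\<forall>u\<in>S. \<exists>T. u \<in> T \<and> T \<subseteq> S \<and> openin (Euclidean_space n) T \<and> continuous_on T f"
  shows "continuous_on S f"
  unfolding continuous_on_eq_continuous_within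
proof
  fix u assume u: "u \<in> S"
  then obtain T where T: "u \<in> T" "T \<subseteq> S" "openin (Euclidean_space n) T" "continuous_on T f"
    using assms by meson
  obtain X where X: "open X" "T = X \<inter> {u. \<forall>i\<ge>n. u i = 0}"
    using T(3) unfolding openin_Euclidean_space_iff by blast
  \<comment> \<open>Each point of \<open>S\<close> lies in some relatively open \<open>T\<close>, so
    \<open>S\<close> itself lies in the coordinate subspace. Hence \<open>S\<close> and
    \<open>T\<close> coincide inside the open set \<open>X\<close>.\<close>
  have "w \<in> {u. \<forall>i\<ge>n. u i = 0}" if w: "w \<in> S" for w
  proof -
    obtain T where "w \<in> T" "openin (Euclidean_space n) T"
      using assms w by meson
    thus ?thesis unfolding openin_Euclidean_space_iff by blast
  qed
  hence "S \<inter> X = T \<inter> X" using X T(2) by blast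
  hence "at u within S = at u within T"
    using X T(1) by (intro at_within_nhd[of u X]) auto
  thus "continuous (at u within S) f"
    using T by (simp add: continuous_on_eq_continuous_within)
qed

text \<open>Differentiability along coordinate lines and the value of a partial derivative refer to
  no domain, so continuity is the only clause that has to be glued.\<close>

lemma C_k_on_local:
  "\<forall>u\<in>S. \<exists>T. u \<in> T \<and> T \<subseteq> S \<and> openin (Euclidean_space n) T \<and> C_k_on n k T f \<Longrightarrow>
     C_k_on n k S f"
proof (induction k arbitrary: f)
  case 0
  show ?case
    unfolding C_k_on.simps by (rule continuous_on_local[where n = n]) (use 0 in simp)
next
  case (Suc k)
  have "continuous_on S f"
    by (rule continuous_on_local[where n = n]) (use Suc.prems C_k_on_continuous in meson)
  moreover have "C_k_on n k S (partial_deriv i f)" if "i < n" for i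
    by (rule Suc.IH) (use Suc.prems that in \<open>unfold C_k_on.simps, meson\<close>)
  moreover have "(\<lambda>t. f (u(i := t))) differentiable at (u i)" if "i < n" "u \<in> S" for i u
    using Suc.prems that unfolding C_k_on.simps by meson
  ultimately show ?case by (simp del: fun_upd_apply)
qed

lemma partial_deriv_has_derivative:
  assumes "C_k_on n (Suc k) S f" "u \<in> S" "i < n"
  shows "((\<lambda>t. f (u(i := t))) has_field_derivative partial_deriv i f u) (at (u i))"
  using assms unfolding partial_deriv_def
  by (auto simp: DERIV_deriv_iff_real_differentiable)

lemma partial_deriv_const [simp]: "partial_deriv i (\<lambda>u. c) = (\<lambda>u. 0)"
  by (simp add: partial_deriv_def fun_eq_iff)

lemma partial_deriv_add:
  assumes "C_k_on n (Suc k) S f" "C_k_on n (Suc k) S g" "u \<in> S" "i < n"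
  shows "partial_deriv i (\<lambda>w. f w + g w) u = partial_deriv i f u + partial_deriv i g u"
    and "(\<lambda>t. f (u(i := t)) + g (u(i := t))) differentiable at (u i)"
proof -
  have D: "((\<lambda>t. f (u(i := t)) + g (u(i := t))) has_field_derivative
      partial_deriv i f u + partial_deriv i g u) (at (u i))"
    using assms by (intro DERIV_add partial_deriv_has_derivative)
  thus "partial_deriv i (\<lambda>w. f w + g w) u = partial_deriv i f u + partial_deriv i g u"
    unfolding partial_deriv_def by (rule DERIV_imp_deriv)
  show "(\<lambda>t. f (u(i := t)) + g (u(i := t))) differentiable at (u i)"
    using D real_differentiable_def by blast
qed

lemma partial_deriv_mult:
  assumes "C_k_on n (Suc k) S f" "C_k_on n (Suc k) S g" "u \<in> S" "i < n"
  shows "partial_deriv i (\<lambda>w. f w * g w) u = partial_deriv i f u * g u + f u * partial_deriv i g u"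
    and "(\<lambda>t. f (u(i := t)) * g (u(i := t))) differentiable at (u i)"
proof -
  have D: "((\<lambda>t. f (u(i := t)) * g (u(i := t))) has_field_derivative
      partial_deriv i f u * g u + f u * partial_deriv i g u) (at (u i))"
    using DERIV_mult[OF partial_deriv_has_derivative[OF assms(1,3,4)]
        partial_deriv_has_derivative[OF assms(2,3,4)]] by (simp add: algebra_simps)
  thus "partial_deriv i (\<lambda>w. f w * g w) u = partial_deriv i f u * g u + f u * partial_deriv i g u"
    unfolding partial_deriv_def by (rule DERIV_imp_deriv)
  show "(\<lambda>t. f (u(i := t)) * g (u(i := t))) differentiable at (u i)"
    using D real_differentiable_def by blast
qed

lemma C_k_on_const: "C_k_on n k S (\<lambda>u. c)"
  by (induction k arbitrary: c) (auto simp: continuous_on_const)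

lemma C_k_on_add:
  assumes S: "openin (Euclidean_space n) S"
  shows "C_k_on n k S f \<Longrightarrow> C_k_on n k S g \<Longrightarrow> C_k_on n k S (\<lambda>u. f u + g u)"
proof (induction k arbitrary: f g)
  case 0
  thus ?case by (simp add: continuous_on_add)
next
  case (Suc k)
  have "C_k_on n k S (partial_deriv i (\<lambda>u. f u + g u))" if "i < n" for i
  proof (rule C_k_on_cong[OF S])
    show "C_k_on n k S (\<lambda>u. partial_deriv i f u + partial_deriv i g u)"
      using Suc that by simp
  qed (simp add: partial_deriv_add[OF Suc.prems _ that])
  moreover have "continuous_on S (\<lambda>u. f u + g u)"
    using Suc.prems by (simp add: continuous_on_add)
  ultimately show ?case
    using partial_deriv_add(2)[OF Suc.prems] by (simp del: fun_upd_apply)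
qed

lemma C_k_on_mult:
  assumes S: "openin (Euclidean_space n) S"
  shows "C_k_on n k S f \<Longrightarrow> C_k_on n k S g \<Longrightarrow> C_k_on n k S (\<lambda>u. f u * g u)"
proof (induction k arbitrary: f g)
  case 0
  thus ?case by (simp add: continuous_on_mult)
next
  case (Suc k)
  have "C_k_on n k S (partial_deriv i (\<lambda>u. f u * g u))" if "i < n" for i
  proof (rule C_k_on_cong[OF S])
    \<comment> \<open>The product rule multiplies partial derivatives, which have order
      \<open>k\<close>, by \<open>f\<close> and \<open>g\<close> themselves, which are therefore
      lowered from order \<open>Suc k\<close> to \<open>k\<close>.\<close>
    show "C_k_on n k S (\<lambda>u. partial_deriv i f u * g u + f u * partial_deriv i g u)"
      using Suc.prems[THEN C_k_on_lower] Suc.prems that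
      by (intro C_k_on_add[OF S] Suc.IH) simp_all
  qed (simp add: partial_deriv_mult[OF Suc.prems _ that])
  moreover have "continuous_on S (\<lambda>u. f u * g u)"
    using Suc.prems by (simp add: continuous_on_mult)
  ultimately show ?case
    using partial_deriv_mult(2)[OF Suc.prems] by (simp del: fun_upd_apply)
qed

lemma C_inf_on_partial_deriv: "C_inf_on n S f \<Longrightarrow> i < n \<Longrightarrow> C_inf_on n S (partial_deriv i f)"
  unfolding C_inf_on_def
proof
  fix k
  assume "\<forall>k. C_k_on n k S f" "i < n"
  hence "C_k_on n (Suc k) S f" by blast
  thus "C_k_on n k S (partial_deriv i f)" using \<open>i < n\<close> by simp
qed

lemma C_inf_on_const: "C_inf_on n S (\<lambda>u. c)"
  by (simp add: C_inf_on_def C_k_on_const)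

lemma C_inf_on_cong:
  "openin (Euclidean_space n) S \<Longrightarrow> (\<And>u. u \<in> S \<Longrightarrow> f u = g u) \<Longrightarrow> C_inf_on n S f \<Longrightarrow> C_inf_on n S g"
  unfolding C_inf_on_def using C_k_on_cong by blast

lemma C_inf_on_add:
  "openin (Euclidean_space n) S \<Longrightarrow> C_inf_on n S f \<Longrightarrow> C_inf_on n S g \<Longrightarrow> C_inf_on n S (\<lambda>u. f u + g u)"
  by (simp add: C_inf_on_def C_k_on_add)

lemma C_inf_on_mult:
  "openin (Euclidean_space n) S \<Longrightarrow> C_inf_on n S f \<Longrightarrow> C_inf_on n S g \<Longrightarrow> C_inf_on n S (\<lambda>u. f u * g u)"
  by (simp add: C_inf_on_def C_k_on_mult)

lemma C_inf_on_sum: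
  assumes "openin (Euclidean_space n) S" "finite I" "\<And>i. i \<in> I \<Longrightarrow> C_inf_on n S (f i)"
  shows "C_inf_on n S (\<lambda>u. \<Sum>i\<in>I. f i u)"
  using assms(2,3) by induction (simp_all add: C_inf_on_const C_inf_on_add assms(1))

lemma C_inf_on_local:
  "\<forall>u\<in>S. \<exists>T. u \<in> T \<and> T \<subseteq> S \<and> openin (Euclidean_space n) T \<and> C_inf_on n T f \<Longrightarrow>
     C_inf_on n S f"
  unfolding C_inf_on_def by (intro allI C_k_on_local) meson

lemma C_inf_on_subset: "C_inf_on n S f \<Longrightarrow> T \<subseteq> S \<Longrightarrow> C_inf_on n T f"
  unfolding C_inf_on_def using C_k_on_subset by blast

section \<open>Charts and smooth functions on a manifold\<close>

text \<open>A homeomorphism is open onto its image, and the image of a chart is itself open in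
  coordinate space. This supplies the openness hypothesis of the preceding calculus in every
  chart.\<close>

lemma openin_chart_image:
  assumes "chart_on n U \<phi>" "open W"
  shows "openin (Euclidean_space n) (\<phi> ` (U \<inter> W))"
proof -
  have hom: "homeomorphism U (\<phi> ` U) \<phi> (inv_into U \<phi>)" and "openin (Euclidean_space n) (\<phi> ` U)"
    using assms(1) by (simp_all add: chart_on_def)
  then obtain Y where Y: "open Y" "\<phi> ` U = Y \<inter> {u. \<forall>i\<ge>n. u i = 0}"
    unfolding openin_Euclidean_space_iff by blast
  have "openin (top_of_set U) (U \<inter> W)"
    using assms(2) by (simp add: openin_open_Int)
  from homeomorphism_imp_open_map[OF hom this]
  obtain X where "open X" "\<phi> ` (U \<inter> W) = \<phi> ` U \<inter> X"
    by (auto simp: openin_open)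
  thus ?thesis
    unfolding openin_Euclidean_space_iff using Y by (intro exI[of _ "Y \<inter> X"]) auto
qed

lemma chart_inv: "chart_on n U \<phi> \<Longrightarrow> x \<in> U \<Longrightarrow> inv_into U \<phi> (\<phi> x) = x"
  by (auto simp: chart_on_def homeomorphism_def)

lemma smooth_manifold_chart: "smooth_manifold M \<Longrightarrow> (U, \<phi>) \<in> atlas M \<Longrightarrow> chart_on (mdim M) U \<phi>"
  by (auto simp: smooth_manifold_def)

lemma smooth_onI:
  "(\<And>U \<phi>. (U, \<phi>) \<in> atlas M \<Longrightarrow>
     C_inf_on (mdim M) (\<phi> ` (U \<inter> W)) (\<lambda>u. f (inv_into U \<phi> u))) \<Longrightarrow> smooth_on M W f"
  unfolding smooth_on_def o_def by blast

lemma smooth_onD: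
  "smooth_on M W f \<Longrightarrow> (U, \<phi>) \<in> atlas M \<Longrightarrow>
     C_inf_on (mdim M) (\<phi> ` (U \<inter> W)) (\<lambda>u. f (inv_into U \<phi> u))"
  unfolding smooth_on_def o_def by blast

lemma smooth_on_const: "smooth_on M W (\<lambda>x. c)"
  by (auto simp: smooth_on_def o_def C_inf_on_const)

lemma smooth_on_subset: "smooth_on M W f \<Longrightarrow> T \<subseteq> W \<Longrightarrow> smooth_on M T f"
  by (rule smooth_onI, rule C_inf_on_subset[OF smooth_onD], assumption+) blast

lemma smooth_on_add:
  assumes "smooth_manifold M" "open W" "smooth_on M W f" "smooth_on M W g"
  shows "smooth_on M W (\<lambda>x. f x + g x)"
  by (rule smooth_onI, rule C_inf_on_add)
     (rule openin_chart_image[OF smooth_manifold_chart] smooth_onD assms | assumption)+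

lemma smooth_on_mult:
  assumes "smooth_manifold M" "open W" "smooth_on M W f" "smooth_on M W g"
  shows "smooth_on M W (\<lambda>x. f x * g x)"
  by (rule smooth_onI, rule C_inf_on_mult)
     (rule openin_chart_image[OF smooth_manifold_chart] smooth_onD assms | assumption)+

lemma smooth_on_sum:
  assumes "smooth_manifold M" "open W" "finite I" "\<And>i. i \<in> I \<Longrightarrow> smooth_on M W (f i)"
  shows "smooth_on M W (\<lambda>x. \<Sum>i\<in>I. f i x)"
  using assms(3,4) by induction (simp_all add: smooth_on_const smooth_on_add assms(1,2))

lemma smooth_on_cong:
  assumes "smooth_manifold M" "open W" "\<And>x. x \<in> W \<Longrightarrow> f x = g x" "smooth_on M W f"
  shows "smooth_on M W g"
proof (rule smooth_onI)
  fix U \<phi> assume a: "(U, \<phi>) \<in> atlas M"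
  note ch = smooth_manifold_chart[OF assms(1) a]
  show "C_inf_on (mdim M) (\<phi> ` (U \<inter> W)) (\<lambda>u. g (inv_into U \<phi> u))"
  proof (rule C_inf_on_cong[OF openin_chart_image[OF ch assms(2)]])
    show "C_inf_on (mdim M) (\<phi> ` (U \<inter> W)) (\<lambda>u. f (inv_into U \<phi> u))"
      by (rule smooth_onD[OF assms(4) a])
  qed (auto simp: chart_inv[OF ch] assms(3))
qed

lemma smooth_on_local:
  assumes "smooth_manifold M" "open W" "\<forall>x\<in>W. \<exists>T. open T \<and> x \<in> T \<and> smooth_on M (T \<inter> W) f"
  shows "smooth_on M W f"
proof (rule smooth_onI)
  fix U \<phi> assume a: "(U, \<phi>) \<in> atlas M"
  note ch = smooth_manifold_chart[OF assms(1) a]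
  show "C_inf_on (mdim M) (\<phi> ` (U \<inter> W)) (\<lambda>u. f (inv_into U \<phi> u))"
  proof (intro C_inf_on_local ballI)
    fix u assume "u \<in> \<phi> ` (U \<inter> W)"
    then obtain x where x: "x \<in> U" "x \<in> W" "u = \<phi> x" by blast
    then obtain T where T: "open T" "x \<in> T" "smooth_on M (T \<inter> W) f"
      using assms(3) by blast
    show "\<exists>T. u \<in> T \<and> T \<subseteq> \<phi> ` (U \<inter> W) \<and> openin (Euclidean_space (mdim M)) T \<and>
        C_inf_on (mdim M) T (\<lambda>u. f (inv_into U \<phi> u))"
      using x T(2) openin_chart_image[OF ch open_Int[OF T(1) assms(2)]] smooth_onD[OF T(3) a]
      by (intro exI[of _ "\<phi> ` (U \<inter> (T \<inter> W))"]) auto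
  qed
qed

lemma smooth_functions_const: "(\<lambda>x. c) \<in> smooth_functions M"
  by (simp add: smooth_functions_def smooth_on_const)

lemma smooth_functions_add:
  "smooth_manifold M \<Longrightarrow> f \<in> smooth_functions M \<Longrightarrow> g \<in> smooth_functions M \<Longrightarrow>
     (\<lambda>x. f x + g x) \<in> smooth_functions M"
  by (simp add: smooth_functions_def smooth_on_add)

lemma smooth_functions_mult:
  "smooth_manifold M \<Longrightarrow> f \<in> smooth_functions M \<Longrightarrow> g \<in> smooth_functions M \<Longrightarrow>
     (\<lambda>x. f x * g x) \<in> smooth_functions M"
  by (simp add: smooth_functions_def smooth_on_mult)

lemma smooth_functions_sum:
  "smooth_manifold M \<Longrightarrow> finite I \<Longrightarrow> (\<And>i. i \<in> I \<Longrightarrow> f i \<in> smooth_functions M) \<Longrightarrow>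
     (\<lambda>x. \<Sum>i\<in>I. f i x) \<in> smooth_functions M"
  by (simp add: smooth_functions_def smooth_on_sum)

lemma smooth_functions_near: "f \<in> smooth_functions M \<Longrightarrow> f \<in> smooth_near M x"
  unfolding smooth_functions_def smooth_near_def by blast

section \<open>Tangent vectors as derivations\<close>

lemma partial_deriv_coordinate: "partial_deriv i (\<lambda>w. w j) u = (if i = j then 1 else 0)"
  by (simp add: partial_deriv_def)

text \<open>Membership in \<open>tangent_space\<close> only says that some coefficients exist;
  evaluating \<open>v\<close> on the coordinate functions identifies them.\<close>

lemma tangent_vector_in_chart:
  assumes M: "smooth_manifold M" and v: "v \<in> tangent_space M x"
    and a: "(U, \<phi>) \<in> atlas M" and x: "x \<in> U" and f: "f \<in> smooth_functions M"
  shows "v f = (\<Sum>i<mdim M. v (\<lambda>y. \<phi> y i) * partial_deriv i (f \<circ> inv_into U \<phi>) (\<phi> x))"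
proof -
  note ch = smooth_manifold_chart[OF M a]
  obtain c where c: "\<And>f. f \<in> smooth_near M x \<Longrightarrow>
      v f = (\<Sum>i<mdim M. c i * partial_deriv i (f \<circ> inv_into U \<phi>) (\<phi> x))"
    using v a x unfolding tangent_space_def by fast
  have U: "open U" using ch by (simp add: chart_on_def)
  have "v (\<lambda>y. \<phi> y j) = c j" if j: "j < mdim M" for j
  proof -
    \<comment> \<open>Coordinate functions are known to be smooth only on the chart domain. This is
      enough because the formula for \<open>v\<close> holds on all of
      \<open>smooth_near M x\<close>, not just for globally smooth functions.\<close>
    have "smooth_on M U (\<lambda>y. \<phi> y j)"
      using M a j unfolding smooth_manifold_def by fast
    hence "(\<lambda>y. \<phi> y j) \<in> smooth_near M x"
      using U x unfolding smooth_near_def by blast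
    hence "v (\<lambda>y. \<phi> y j) =
        (\<Sum>i<mdim M. c i * partial_deriv i ((\<lambda>y. \<phi> y j) \<circ> inv_into U \<phi>) (\<phi> x))"
      by (rule c)
    also have "\<dots> = (\<Sum>i<mdim M. c i * partial_deriv i (\<lambda>w. w j) (\<phi> x))"
    proof (rule sum.cong[OF refl])
      fix i assume "i \<in> {..<mdim M}"
      \<comment> \<open>Composed with the inverse chart, a coordinate function is a projection only
        on the chart image; locality of partial derivatives on that open set suffices.\<close>
      hence "partial_deriv i ((\<lambda>y. \<phi> y j) \<circ> inv_into U \<phi>) (\<phi> x) = partial_deriv i (\<lambda>w. w j) (\<phi> x)"
        using openin_chart_image[OF ch open_UNIV] x
        by (intro partial_deriv_cong) (auto simp: chart_inv[OF ch])
      thus "c i * partial_deriv i ((\<lambda>y. \<phi> y j) \<circ> inv_into U \<phi>) (\<phi> x) =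
          c i * partial_deriv i (\<lambda>w. w j) (\<phi> x)" by simp
    qed
    also have "\<dots> = c j"
      using j by (simp add: partial_deriv_coordinate if_distrib cong: if_cong)
    finally show ?thesis .
  qed
  thus ?thesis
    using c[OF smooth_functions_near[OF f]] by simp
qed

text \<open>In one chart around \<open>x\<close>, \<open>v\<close> is a linear combination of
  partial derivatives, so the sum and product rules for these carry over term by term.\<close>

lemma tangent_vector_derivation:
  assumes M: "smooth_manifold M" and v: "v \<in> tangent_space M x"
    and f: "f \<in> smooth_functions M" and g: "g \<in> smooth_functions M"
  shows "v (\<lambda>y. f y + g y) = v f + v g"
    and "v (\<lambda>y. f y * g y) = v f * g x + f x * v g"
    and "v (\<lambda>y. c) = 0"
proof -
  obtain U \<phi> where a: "(U, \<phi>) \<in> atlas M" and x: "x \<in> U"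
    using M unfolding smooth_manifold_def by fast
  note ch = smooth_manifold_chart[OF M a]
  have C: "C_k_on (mdim M) (Suc 0) (\<phi> ` (U \<inter> UNIV)) (h \<circ> inv_into U \<phi>)"
    if "h \<in> smooth_functions M" for h
    using smooth_onD[OF _ a, of UNIV h] that
    unfolding smooth_functions_def C_inf_on_def o_def by blast
  have x': "\<phi> x \<in> \<phi> ` (U \<inter> UNIV)" using x by simp
  note loc = tangent_vector_in_chart[OF M v a x]
  show "v (\<lambda>y. f y + g y) = v f + v g"
    using partial_deriv_add(1)[OF C[OF f] C[OF g] x']
    by (simp add: loc[OF f] loc[OF g] loc[OF smooth_functions_add[OF M f g]] o_def
        sum.distrib ring_distribs)
  show "v (\<lambda>y. f y * g y) = v f * g x + f x * v g"
    using partial_deriv_mult(1)[OF C[OF f] C[OF g] x']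
    by (simp add: loc[OF f] loc[OF g] loc[OF smooth_functions_mult[OF M f g]] o_def
        chart_inv[OF ch x] sum.distrib ring_distribs sum_distrib_left sum_distrib_right mult_ac)
  show "v (\<lambda>y. c) = 0"
    by (simp add: loc[OF smooth_functions_const] o_def)
qed

section \<open>Sections and bundle maps in local frames\<close>

lemma vbundle_triv_linear:
  assumes "smooth_vbundle E" "(U, h) \<in> trivs E" "x \<in> U"
  shows "bij_betw h (fibre E x) {u. \<forall>i\<ge>rank E. u i = 0}"
    and "h (vzero E x) = (\<lambda>i. 0)"
    and "a \<in> fibre E x \<Longrightarrow> b \<in> fibre E x \<Longrightarrow> h (vadd E a b) = (\<lambda>i. h a i + h b i)"
    and "a \<in> fibre E x \<Longrightarrow> h (vscale E c a) = (\<lambda>i. c * h a i)"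
proof -
  have "\<forall>(U, h) \<in> trivs E. open U \<and>
        (\<forall>x \<in> U. bij_betw h (fibre E x) {u. \<forall>i\<ge>rank E. u i = 0} \<and>
           h (vzero E x) = (\<lambda>i. 0) \<and>
           (\<forall>a \<in> fibre E x. \<forall>b \<in> fibre E x. h (vadd E a b) = (\<lambda>i. h a i + h b i)) \<and>
           (\<forall>a \<in> fibre E x. \<forall>c. h (vscale E c a) = (\<lambda>i. c * h a i)))"
    using assms(1) unfolding smooth_vbundle_def topspace_Euclidean_space by (elim conjE)
  from bspec[OF this assms(2)] assms(3)
  have *: "bij_betw h (fibre E x) {u. \<forall>i\<ge>rank E. u i = 0} \<and>
           h (vzero E x) = (\<lambda>i. 0) \<and>
           (\<forall>a \<in> fibre E x. \<forall>b \<in> fibre E x. h (vadd E a b) = (\<lambda>i. h a i + h b i)) \<and>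
           (\<forall>a \<in> fibre E x. \<forall>c. h (vscale E c a) = (\<lambda>i. c * h a i))"
    by simp
  show "bij_betw h (fibre E x) {u. \<forall>i\<ge>rank E. u i = 0}"
    and "h (vzero E x) = (\<lambda>i. 0)"
    and "a \<in> fibre E x \<Longrightarrow> b \<in> fibre E x \<Longrightarrow> h (vadd E a b) = (\<lambda>i. h a i + h b i)"
    and "a \<in> fibre E x \<Longrightarrow> h (vscale E c a) = (\<lambda>i. c * h a i)"
    using * by blast+
qed

lemma vbundle_triv_open: "smooth_vbundle E \<Longrightarrow> (U, h) \<in> trivs E \<Longrightarrow> open U"
  unfolding smooth_vbundle_def by (elim conjE) fast

lemma vbundle_fibre_closed:
  assumes "smooth_vbundle E"
  shows "vzero E x \<in> fibre E x"
    and "a \<in> fibre E x \<Longrightarrow> b \<in> fibre E x \<Longrightarrow> vadd E a b \<in> fibre E x"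
    and "a \<in> fibre E x \<Longrightarrow> vscale E c a \<in> fibre E x"
  using assms unfolding smooth_vbundle_def by (elim conjE; simp)+

lemma vbundle_triv_at:
  assumes "smooth_vbundle E"
  obtains U h where "(U, h) \<in> trivs E" "x \<in> U" "open U"
proof -
  have "(\<Union>(U, h) \<in> trivs E. U) = UNIV"
    using assms unfolding smooth_vbundle_def by (elim conjE)
  hence "x \<in> (\<Union>(U, h) \<in> trivs E. U)" by simp
  then obtain U h where "(U, h) \<in> trivs E" "x \<in> U" by fast
  thus ?thesis using that vbundle_triv_open[OF assms] by blast
qed

text \<open>Induction on a bound \<open>m\<close> for the coordinates of \<open>e\<close> that may
  be nonzero: subtracting the top component times its frame vector lowers the bound. Only the record
  operations \<open>vadd\<close> and \<open>vscale\<close>, transported through \<open>h\<close>,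
  are used.\<close>

lemma linear_functional_frame_expansion:
  fixes l :: "'e \<Rightarrow> real"
  assumes E: "smooth_vbundle E" and t: "(U, h) \<in> trivs E" "x \<in> U"
    and ladd: "\<And>a b. a \<in> fibre E x \<Longrightarrow> b \<in> fibre E x \<Longrightarrow> l (vadd E a b) = l a + l b"
    and lscale: "\<And>a c. a \<in> fibre E x \<Longrightarrow> l (vscale E c a) = c * l a"
    and e: "e \<in> fibre E x"
  shows "l e = (\<Sum>j<rank E. h e j * l (inv_into (fibre E x) h (\<lambda>i. if i = j then 1 else 0)))"
proof -
  note lin = vbundle_triv_linear[OF E t]
  note clo = vbundle_fibre_closed[OF E]
  define b where "b j = inv_into (fibre E x) h (\<lambda>i. if i = j then 1 else 0)" for j
  have b: "b j \<in> fibre E x" "h (b j) = (\<lambda>i. if i = j then 1 else 0)" if "j < rank E" for j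
  proof -
    have "(\<lambda>i. if i = j then 1 else 0) \<in> h ` fibre E x"
      using lin(1) that by (auto simp: bij_betw_def)
    thus "b j \<in> fibre E x" "h (b j) = (\<lambda>i. if i = j then 1 else 0)"
      unfolding b_def by (rule inv_into_into, rule f_inv_into_f)
  qed
  have "m \<le> rank E \<Longrightarrow> e \<in> fibre E x \<Longrightarrow> \<forall>j\<ge>m. h e j = 0 \<Longrightarrow>
      l e = (\<Sum>j<m. h e j * l (b j))" for m e
  proof (induction m arbitrary: e)
    case 0
    \<comment> \<open>With all coordinates zero, injectivity of \<open>h\<close> gives that
      \<open>e\<close> equals its own multiple by 0, on which \<open>l\<close> vanishes by
      homogeneity.\<close>
    have "h e = h (vscale E 0 e)"
      using 0 lin(4) by auto
    hence "e = vscale E 0 e"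
      using lin(1) 0(2) clo(3)[OF 0(2)] unfolding bij_betw_def by (meson inj_onD)
    thus ?case
      using lscale[OF 0(2), of 0] by simp
  next
    case (Suc m)
    note bm = b[of m]
    \<comment> \<open>Subtracting the \<open>m\<close>-th component makes coordinate
      \<open>m\<close> vanish and leaves the others unchanged.\<close>
    define e' where "e' = vadd E e (vscale E (- h e m) (b m))"
    have e': "e' \<in> fibre E x"
      unfolding e'_def using Suc.prems bm by (intro clo) auto
    have he': "h e' j = (if j = m then 0 else h e j)" for j
      unfolding e'_def using Suc.prems bm clo(3) by (simp add: lin(3,4))
    have "l e' = (\<Sum>j<m. h e' j * l (b j))"
      using Suc.prems e' he' by (intro Suc.IH) (auto simp: le_Suc_eq Suc_le_eq)
    moreover have "l e' = l e - h e m * l (b m)"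
      unfolding e'_def using Suc.prems bm clo(3) by (simp add: ladd lscale)
    ultimately show ?case
      by (simp add: he')
  qed
  from this[OF order_refl e] show ?thesis
    using lin(1) e unfolding b_def bij_betw_def by blast
qed

text \<open>Near each point, expanding in a frame of \<open>E\<close> gives a sum of products of
  smooth section components and smooth matrix entries. Of \<open>F\<close> only additivity and
  homogeneity of the one component are assumed, so the lemma applies to the tangent bundle without
  first showing that it is a smooth vector bundle.\<close>

lemma smooth_bundle_map_component:
  assumes E: "smooth_vbundle E" and \<Phi>: "smooth_bundle_map E F \<Phi>" and s: "s \<in> sections E"
    and k: "(W, k) \<in> trivs F" "open W" "i < rank F"
    and kadd: "\<And>x a b. x \<in> W \<Longrightarrow> a \<in> fibre F x \<Longrightarrow> b \<in> fibre F x \<Longrightarrow> k (vadd F a b) i = k a i + k b i"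
    and kscale: "\<And>x a c. x \<in> W \<Longrightarrow> a \<in> fibre F x \<Longrightarrow> k (vscale F c a) i = c * k a i"
  shows "smooth_on (base E) W (\<lambda>x. k (\<Phi> (s x)) i)"
proof (rule smooth_on_local[OF _ \<open>open W\<close>])
  show M: "smooth_manifold (base E)" using E by (simp add: smooth_vbundle_def)
  have lin: "fibre_linear E F \<Phi>" using \<Phi> by (simp add: smooth_bundle_map_def)
  show "\<forall>x\<in>W. \<exists>T. open T \<and> x \<in> T \<and> smooth_on (base E) (T \<inter> W) (\<lambda>x. k (\<Phi> (s x)) i)"
  proof
    fix x assume "x \<in> W"
    obtain U h where U: "(U, h) \<in> trivs E" "x \<in> U" "open U"
      using vbundle_triv_at[OF E] .
    have "smooth_on (base E) (U \<inter> W) (\<lambda>x. k (\<Phi> (s x)) i)"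
    proof (rule smooth_on_cong[OF M])
      show "open (U \<inter> W)" using U \<open>open W\<close> by auto
      have "smooth_on (base E) (U \<inter> W) (\<lambda>y. h (s y) j)" if "j < rank E" for j
        using s U(1) that unfolding sections_def by (blast intro: smooth_on_subset)
      moreover have "smooth_on (base E) (U \<inter> W) (frame_matrix E h k \<Phi> i j)" if "j < rank E" for j
        using \<Phi> U(1) k that unfolding smooth_bundle_map_def by blast
      ultimately show "smooth_on (base E) (U \<inter> W)
          (\<lambda>y. \<Sum>j<rank E. h (s y) j * frame_matrix E h k \<Phi> i j y)"
        by (intro smooth_on_sum smooth_on_mult M \<open>open (U \<inter> W)\<close>) auto
      show "(\<Sum>j<rank E. h (s y) j * frame_matrix E h k \<Phi> i j y) = k (\<Phi> (s y)) i"
        if y: "y \<in> U \<inter> W" for y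
        unfolding frame_matrix_def
      proof (rule linear_functional_frame_expansion[OF E U(1), where l = "\<lambda>e. k (\<Phi> e) i", symmetric])
        show "y \<in> U" using y by simp
        show "s y \<in> fibre E y" using s by (simp add: sections_def)
        show "k (\<Phi> (vadd E a b)) i = k (\<Phi> a) i + k (\<Phi> b) i"
          if "a \<in> fibre E y" "b \<in> fibre E y" for a b
          using lin that y kadd[of y "\<Phi> a" "\<Phi> b"] unfolding fibre_linear_def by auto
        show "k (\<Phi> (vscale E c a)) i = c * k (\<Phi> a) i" if "a \<in> fibre E y" for a c
          using lin that y kscale[of y "\<Phi> a" c] unfolding fibre_linear_def by auto
      qed
    qed
    thus "\<exists>T. open T \<and> x \<in> T \<and> smooth_on (base E) (T \<inter> W) (\<lambda>x. k (\<Phi> (s x)) i)"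
      using U by blast
  qed
qed

section \<open>Closure of sections under sums and smooth multiples\<close>

lemma section_component_smooth:
  "s \<in> sections E \<Longrightarrow> (U, h) \<in> trivs E \<Longrightarrow> i < rank E \<Longrightarrow> smooth_on (base E) U (\<lambda>x. h (s x) i)"
  unfolding sections_def by fast

lemma sec_add_in_sections:
  assumes E: "smooth_vbundle E" and s: "s \<in> sections E" "t \<in> sections E"
  shows "sec_add E s t \<in> sections E"
proof -
  have fib: "\<And>x. s x \<in> fibre E x" "\<And>x. t x \<in> fibre E x"
    using s by (simp_all add: sections_def)
  have M: "smooth_manifold (base E)" using E by (simp add: smooth_vbundle_def)
  have "smooth_on (base E) U (\<lambda>x. h (vadd E (s x) (t x)) i)"
    if t: "(U, h) \<in> trivs E" and i: "i < rank E" for U h i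
  proof (rule smooth_on_cong[OF M])
    show U: "open U" by (rule vbundle_triv_open[OF E t])
    show "smooth_on (base E) U (\<lambda>x. h (s x) i + h (t x) i)"
      by (intro smooth_on_add M U section_component_smooth[OF _ that] s)
  qed (simp add: vbundle_triv_linear(3)[OF E t] fib)
  thus ?thesis
    unfolding sections_def sec_add_def using vbundle_fibre_closed(2)[OF E] fib by blast
qed

lemma sec_scale_in_sections:
  assumes E: "smooth_vbundle E" and s: "s \<in> sections E" and f: "f \<in> smooth_functions (base E)"
  shows "sec_scale E f s \<in> sections E"
proof -
  have fib: "\<And>x. s x \<in> fibre E x"
    using s by (simp add: sections_def)
  have M: "smooth_manifold (base E)" using E by (simp add: smooth_vbundle_def)
  have "smooth_on (base E) U (\<lambda>x. h (vscale E (f x) (s x)) i)"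
    if t: "(U, h) \<in> trivs E" and i: "i < rank E" for U h i
  proof (rule smooth_on_cong[OF M])
    show U: "open U" by (rule vbundle_triv_open[OF E t])
    have "smooth_on (base E) U f"
      using f smooth_on_subset unfolding smooth_functions_def by blast
    thus "smooth_on (base E) U (\<lambda>x. f x * h (s x) i)"
      by (intro smooth_on_mult M U section_component_smooth[OF _ that] s)
  qed (simp add: vbundle_triv_linear(4)[OF E t] fib)
  thus ?thesis
    unfolding sections_def sec_scale_def using vbundle_fibre_closed(3)[OF E] fib by blast
qed

lemma sec_add_vzero:
  assumes E: "smooth_vbundle E"
  shows "sec_add E (vzero E) (vzero E) = vzero E"
proof
  fix x
  obtain U h where U: "(U, h) \<in> trivs E" "x \<in> U"
    using vbundle_triv_at[OF E] .
  note lin = vbundle_triv_linear[OF E U] and clo = vbundle_fibre_closed[OF E]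
  have "h (vadd E (vzero E x) (vzero E x)) = h (vzero E x)"
    using lin clo(1) by simp
  thus "sec_add E (vzero E) (vzero E) x = vzero E x"
    unfolding sec_add_def using lin(1) clo(1) clo(2)[OF clo(1) clo(1)]
    unfolding bij_betw_def by (meson inj_onD)
qed

section \<open>Combinatorics of shuffles\<close>

lemma sum_lessThan_plus:
  "(\<Sum>k<p + q. g k) = (\<Sum>k<p. g k) + (\<Sum>k<q. g (p + k :: nat) :: real)"
  by (induction q) simp_all

lemma sum_off_diagonal_swap:
  assumes "finite A"
  shows "(\<Sum>i\<in>A. \<Sum>k\<in>A - {i}. g i k) = (\<Sum>i\<in>A. \<Sum>k\<in>A - {i}. g k i :: real)"
  using assms
  by (simp add: sum.Sigma)
     (rule sum.reindex_bij_witness[of _ prod.swap prod.swap]; auto)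

lemma finite_perm_shuffles: "finite (perm_shuffles p q)"
  by (rule finite_subset[OF _ finite_permutations[of "{..<p + q}"]]) (auto simp: perm_shuffles_def)

text \<open>Since \<open>\<sigma>\<close> is injective, slot \<open>\<sigma> m\<close> is read only
  at index \<open>m\<close>; changing it affects the list for the first factor in one place and the
  list for the second factor not at all.\<close>

lemma shuffle_update_left:
  assumes "\<sigma> permutes {..<p + q}" "length vs = p + q" "m < p"
  shows "map (\<lambda>i. vs[\<sigma> m := w] ! \<sigma> i) [0..<p] = (map (\<lambda>i. vs ! \<sigma> i) [0..<p])[m := w]"
    and "map (\<lambda>i. vs[\<sigma> m := w] ! \<sigma> i) [p..<p + q] = map (\<lambda>i. vs ! \<sigma> i) [p..<p + q]"
proof -
  have inj: "\<sigma> i = \<sigma> j \<longleftrightarrow> i = j" for i j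
    using permutes_inj[OF assms(1)] by (auto dest: injD)
  have lt: "\<sigma> i < p + q" if "i < p + q" for i
    using permutes_in_image[OF assms(1), of i] that by simp
  show "map (\<lambda>i. vs[\<sigma> m := w] ! \<sigma> i) [0..<p] = (map (\<lambda>i. vs ! \<sigma> i) [0..<p])[m := w]"
    by (rule nth_equalityI) (use assms lt in \<open>auto simp: nth_list_update inj\<close>)
  show "map (\<lambda>i. vs[\<sigma> m := w] ! \<sigma> i) [p..<p + q] = map (\<lambda>i. vs ! \<sigma> i) [p..<p + q]"
    using assms by (auto simp: nth_list_update inj)
qed

lemma shuffle_update_right:
  assumes "\<sigma> permutes {..<p + q}" "length vs = p + q" "m < q"
  shows "map (\<lambda>i. vs[\<sigma> (p + m) := w] ! \<sigma> i) [p..<p + q] =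
      (map (\<lambda>i. vs ! \<sigma> i) [p..<p + q])[m := w]"
    and "map (\<lambda>i. vs[\<sigma> (p + m) := w] ! \<sigma> i) [0..<p] = map (\<lambda>i. vs ! \<sigma> i) [0..<p]"
proof -
  have inj: "\<sigma> i = \<sigma> j \<longleftrightarrow> i = j" for i j
    using permutes_inj[OF assms(1)] by (auto dest: injD)
  have lt: "\<sigma> i < p + q" if "i < p + q" for i
    using permutes_in_image[OF assms(1), of i] that by simp
  show "map (\<lambda>i. vs[\<sigma> (p + m) := w] ! \<sigma> i) [p..<p + q] =
      (map (\<lambda>i. vs ! \<sigma> i) [p..<p + q])[m := w]"
    by (rule nth_equalityI) (use assms lt in \<open>auto simp: nth_list_update inj\<close>)
  show "map (\<lambda>i. vs[\<sigma> (p + m) := w] ! \<sigma> i) [0..<p] = map (\<lambda>i. vs ! \<sigma> i) [0..<p]"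
    using assms by (auto simp: nth_list_update inj)
qed

lemma permuted_sublist_subset:
  assumes "\<sigma> permutes {..<length vs}" "set vs \<subseteq> A" "b \<le> length vs"
  shows "set (map (\<lambda>i. vs ! \<sigma> i) [a..<b]) \<subseteq> A"
proof -
  have "\<sigma> i < length vs" if "i < length vs" for i
    using permutes_in_image[OF assms(1), of i] that by simp
  thus ?thesis using assms(2,3) by (auto simp: subset_iff)
qed

text \<open>Every permutation is surjective, so an entry outside \<open>A\<close> reaches one of the
  two factors in every term. This settles the product identities on lists containing
  non-sections.\<close>

lemma wedge_vanishes:
  assumes \<xi>: "\<And>vs. \<not> set vs \<subseteq> A \<Longrightarrow> \<xi> vs = (\<lambda>x. 0)"
    and \<eta>: "\<And>vs. \<not> set vs \<subseteq> A \<Longrightarrow> \<eta> vs = (\<lambda>x. 0)"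
    and vs: "\<not> set vs \<subseteq> A"
  shows "wedge \<xi> \<eta> vs = (\<lambda>x. 0)"
proof -
  have "\<xi> (map (\<lambda>i. vs ! \<sigma> i) [0..<p]) x * \<eta> (map (\<lambda>i. vs ! \<sigma> i) [p..<length vs]) x = 0"
    if p: "p \<le> length vs" and \<sigma>: "\<sigma> \<in> perm_shuffles p (length vs - p)" for p \<sigma> x
  proof -
    obtain k where k: "k < length vs" "vs ! k \<notin> A"
      using vs by (auto simp: in_set_conv_nth subset_iff)
    have "\<sigma> permutes {..<length vs}"
      using \<sigma> p by (simp add: perm_shuffles_def)
    then obtain m where m: "m < length vs" "\<sigma> m = k"
      using k permutes_image by (metis imageE lessThan_iff)
    show ?thesis
    proof (cases "m < p")
      case True
      hence "vs ! k \<in> set (map (\<lambda>i. vs ! \<sigma> i) [0..<p])" using m by auto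
      hence "\<not> set (map (\<lambda>i. vs ! \<sigma> i) [0..<p]) \<subseteq> A" using k by blast
      thus ?thesis using \<xi> by simp
    next
      case False
      hence "vs ! k \<in> set (map (\<lambda>i. vs ! \<sigma> i) [p..<length vs])" using m by auto
      hence "\<not> set (map (\<lambda>i. vs ! \<sigma> i) [p..<length vs]) \<subseteq> A" using k by blast
      thus ?thesis using \<eta> by simp
    qed
  qed
  thus ?thesis
    unfolding wedge_def mult.assoc
    by (intro ext sum.neutral ballI) (simp del: mult_eq_0_iff)
qed

text \<open>Apart from the first value, a (1, q)-shuffle lists the remaining values in increasing
  order, so their set determines it. Conversely, each first value is realised by a cycle.\<close>

lemma shuffles_1_bij: "bij_betw (\<lambda>\<sigma>. \<sigma> 0) (perm_shuffles 1 q) {..<1 + q}"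
proof (rule bij_betw_imageI)
  show "inj_on (\<lambda>\<sigma>. \<sigma> 0) (perm_shuffles 1 q)"
  proof (rule inj_onI)
    fix \<sigma> \<tau> assume \<sigma>: "\<sigma> \<in> perm_shuffles 1 q" and \<tau>: "\<tau> \<in> perm_shuffles 1 q" and eq: "\<sigma> 0 = \<tau> 0"
    have *: "sorted (map \<rho> [1..<1 + q]) \<and> distinct (map \<rho> [1..<1 + q]) \<and>
        set (map \<rho> [1..<1 + q]) = {..<1 + q} - {\<rho> 0}" if "\<rho> \<in> perm_shuffles 1 q" for \<rho>
    proof -
      have \<rho>: "\<rho> permutes {..<1 + q}" "strict_mono_on {1..<1 + q} \<rho>"
        using that by (auto simp: perm_shuffles_def)
      have "{1..<1 + q} = {..<1 + q} - {0}" by auto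
      hence "\<rho> ` {1..<1 + q} = {..<1 + q} - {\<rho> 0}"
        using permutes_image[OF \<rho>(1)] image_set_diff[OF permutes_inj[OF \<rho>(1)], of "{..<1 + q}" "{0}"]
        by simp
      moreover have "sorted (map \<rho> [1..<1 + q])"
        using strict_mono_on_imp_mono_on[OF \<rho>(2)]
        by (auto simp: sorted_iff_nth_mono mono_on_def simp del: upt_Suc)
      ultimately show ?thesis
        using permutes_inj_on[OF \<rho>(1)] by (simp add: distinct_map del: upt_Suc)
    qed
    have "map \<sigma> [1..<1 + q] = map \<tau> [1..<1 + q]"
      using *[OF \<sigma>] *[OF \<tau>] eq by (intro sorted_distinct_set_unique) auto
    hence "\<sigma> i = \<tau> i" if "i \<noteq> 0" "i < 1 + q" for i
      using that by (auto simp del: upt_Suc)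
    moreover have "\<sigma> i = \<tau> i" if "\<not> i < 1 + q" for i
      using \<sigma> \<tau> that by (auto simp: perm_shuffles_def permutes_def)
    ultimately show "\<sigma> = \<tau>" using eq by (metis ext)
  qed
  show "(\<lambda>\<sigma>. \<sigma> 0) ` perm_shuffles 1 q = {..<1 + q}"
  proof safe
    fix \<sigma> assume "\<sigma> \<in> perm_shuffles 1 q"
    hence "\<sigma> permutes {..<1 + q}" by (simp add: perm_shuffles_def)
    from permutes_in_image[OF this, of 0] show "\<sigma> 0 < 1 + q" by simp
  next
    fix k assume k: "k < 1 + q"
    \<comment> \<open>The cycle that brings \<open>k\<close> to the front and moves
      \<open>0, ..., k - 1\<close> up by one position.\<close>
    define \<sigma> where "\<sigma> i = (if i = 0 then k else if i \<le> k then i - 1 else i)" for i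
    have "inj_on \<sigma> {..<1 + q}"
      unfolding inj_on_def \<sigma>_def by (auto split: if_splits)
    moreover have "\<sigma> ` {..<1 + q} \<subseteq> {..<1 + q}"
      using k by (auto simp: \<sigma>_def)
    ultimately have "bij_betw \<sigma> {..<1 + q} {..<1 + q}"
      by (simp add: bij_betw_def endo_inj_surj)
    hence "\<sigma> permutes {..<1 + q}"
      by (rule bij_imp_permutes) (use k in \<open>auto simp: \<sigma>_def\<close>)
    moreover have "strict_mono_on {1..<1 + q} \<sigma>"
      by (auto simp: strict_mono_on_def \<sigma>_def)
    ultimately have "\<sigma> \<in> perm_shuffles 1 q"
      by (auto simp: perm_shuffles_def strict_mono_on_def)
    moreover have "k = \<sigma> 0" by (simp add: \<sigma>_def)
    ultimately show "k \<in> (\<lambda>\<sigma>. \<sigma> 0) ` perm_shuffles 1 q" by blast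
  qed
qed

section \<open>Sections as derivations of the smooth functions\<close>

locale smooth_lie_algebroid =
  fixes L :: "('m::{t2_space, second_countable_topology}, 'e) algebroid"
  assumes lie_algebroid: "lie_algebroid L"
begin

abbreviation anchor_deriv :: "('m \<Rightarrow> 'e) \<Rightarrow> ('m \<Rightarrow> real) \<Rightarrow> 'm \<Rightarrow> real" where
  "anchor_deriv V f \<equiv> d_pair f (anchor L \<circ> V)"

abbreviation smooth_fns :: "('m \<Rightarrow> real) set" where
  "smooth_fns \<equiv> smooth_functions (base L)"

lemma vbundle: "smooth_vbundle L"
  using lie_algebroid by (simp add: lie_algebroid_def)

lemma manifold: "smooth_manifold (base L)"
  using vbundle by (simp add: smooth_vbundle_def)

lemmas smooth_add = smooth_functions_add[OF manifold]
  and smooth_mult = smooth_functions_mult[OF manifold]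
  and smooth_sum = smooth_functions_sum[OF manifold]
  and section_add = sec_add_in_sections[OF vbundle]
  and section_scale = sec_scale_in_sections[OF vbundle]

lemma smooth_uminus: "f \<in> smooth_fns \<Longrightarrow> (\<lambda>x. - f x) \<in> smooth_fns"
  using smooth_mult[OF smooth_functions_const[of "-1"]] by simp

lemma smooth_diff: "f \<in> smooth_fns \<Longrightarrow> g \<in> smooth_fns \<Longrightarrow> (\<lambda>x. f x - g x) \<in> smooth_fns"
  using smooth_add[of f, OF _ smooth_uminus] by simp

lemma section_bracket: "V \<in> sections L \<Longrightarrow> W \<in> sections L \<Longrightarrow> bracket L V W \<in> sections L"
  using lie_algebroid by (simp add: lie_algebroid_def lie_algebra_bracket_def)

lemma anchor_tangent:
  assumes "V \<in> sections L"
  shows "snd (anchor L (V x)) \<in> tangent_space (base L) x"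
proof -
  have "anchor L (V x) \<in> fibre (tangent_bundle (base L)) x"
    using lie_algebroid assms
    unfolding lie_algebroid_def smooth_bundle_map_def fibre_linear_def sections_def by blast
  thus ?thesis by (auto simp: fibre_def tangent_bundle_def)
qed

lemma anchor_deriv_add:
  "V \<in> sections L \<Longrightarrow> f \<in> smooth_fns \<Longrightarrow> g \<in> smooth_fns \<Longrightarrow>
    anchor_deriv V (\<lambda>x. f x + g x) = (\<lambda>x. anchor_deriv V f x + anchor_deriv V g x)"
  using tangent_vector_derivation(1)[OF manifold anchor_tangent] by (simp add: d_pair_def)

lemma anchor_deriv_mult:
  "V \<in> sections L \<Longrightarrow> f \<in> smooth_fns \<Longrightarrow> g \<in> smooth_fns \<Longrightarrow>
    anchor_deriv V (\<lambda>x. f x * g x) = (\<lambda>x. anchor_deriv V f x * g x + f x * anchor_deriv V g x)"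
  using tangent_vector_derivation(2)[OF manifold anchor_tangent] by (simp add: d_pair_def)

lemma anchor_deriv_const: "V \<in> sections L \<Longrightarrow> anchor_deriv V (\<lambda>x. c) = (\<lambda>x. 0)"
  using tangent_vector_derivation(3)[OF manifold anchor_tangent smooth_functions_const
      smooth_functions_const] by (simp add: d_pair_def)

lemma anchor_deriv_scale:
  "V \<in> sections L \<Longrightarrow> f \<in> smooth_fns \<Longrightarrow>
    anchor_deriv V (\<lambda>x. c * f x) = (\<lambda>x. c * anchor_deriv V f x)"
  using anchor_deriv_mult[OF _ smooth_functions_const] by (simp add: anchor_deriv_const)

lemma anchor_deriv_uminus:
  "V \<in> sections L \<Longrightarrow> f \<in> smooth_fns \<Longrightarrow>
    anchor_deriv V (\<lambda>x. - f x) = (\<lambda>x. - anchor_deriv V f x)"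
  using anchor_deriv_scale[of V f "-1"] by simp

lemma anchor_deriv_diff:
  "V \<in> sections L \<Longrightarrow> f \<in> smooth_fns \<Longrightarrow> g \<in> smooth_fns \<Longrightarrow>
    anchor_deriv V (\<lambda>x. f x - g x) = (\<lambda>x. anchor_deriv V f x - anchor_deriv V g x)"
  using anchor_deriv_add[of V f "\<lambda>x. - g x"] by (simp add: anchor_deriv_uminus smooth_uminus)

lemma anchor_deriv_sum:
  assumes "V \<in> sections L" "finite I" "\<And>i. i \<in> I \<Longrightarrow> f i \<in> smooth_fns"
  shows "anchor_deriv V (\<lambda>x. \<Sum>i\<in>I. f i x) = (\<lambda>x. \<Sum>i\<in>I. anchor_deriv V (f i) x)"
  using assms(2,3)
  by induction (simp_all add: anchor_deriv_const anchor_deriv_add smooth_sum assms(1))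

lemma anchor_deriv_sec_scale:
  assumes "V \<in> sections L"
  shows "anchor_deriv (sec_scale L f V) g = (\<lambda>x. f x * anchor_deriv V g x)"
proof
  fix x
  have "anchor L (vscale L (f x) (V x)) = vscale (tangent_bundle (base L)) (f x) (anchor L (V x))"
    using lie_algebroid assms
    unfolding lie_algebroid_def smooth_bundle_map_def fibre_linear_def sections_def by blast
  thus "anchor_deriv (sec_scale L f V) g x = f x * anchor_deriv V g x"
    by (simp add: d_pair_def sec_scale_def tangent_bundle_def)
qed

lemma anchor_deriv_bracket:
  assumes "V \<in> sections L" "W \<in> sections L" "f \<in> smooth_fns"
  shows "anchor_deriv (bracket L V W) f =
    (\<lambda>x. anchor_deriv V (anchor_deriv W f) x - anchor_deriv W (anchor_deriv V f) x)"
proof -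
  have "anchor L \<circ> bracket L V W = vf_bracket (base L) (anchor L \<circ> V) (anchor L \<circ> W)"
    using lie_algebroid assms unfolding lie_algebroid_def by blast
  thus ?thesis
    using smooth_functions_near[OF assms(3)] by (simp add: d_pair_def vf_bracket_def)
qed

lemma anchor_component_smooth:
  assumes V: "V \<in> sections L" and a: "(U, \<phi>) \<in> atlas (base L)" and i: "i < mdim (base L)"
  shows "smooth_on (base L) U (\<lambda>x. snd (anchor L (V x)) (\<lambda>y. \<phi> y i))"
proof -
  \<comment> \<open>This is the fibre component of the tangent bundle over the chart domain,
    including its default value 0 beyond the dimension.\<close>
  let ?k = "\<lambda>b j. if j < mdim (base L) then snd b (\<lambda>y. \<phi> y j) else 0"
  have "smooth_on (base L) U (\<lambda>x. ?k (anchor L (V x)) i)"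
  proof (rule smooth_bundle_map_component[OF vbundle _ V, where k = ?k and \<Phi> = "anchor L" and i = i])
    show "smooth_bundle_map L (tangent_bundle (base L)) (anchor L)"
      using lie_algebroid by (simp add: lie_algebroid_def)
    show "(U, ?k) \<in> trivs (tangent_bundle (base L))"
      using a by (force simp: tangent_bundle_def)
    show "open U"
      using smooth_manifold_chart[OF manifold a] by (simp add: chart_on_def)
  qed (use i in \<open>simp_all add: tangent_bundle_def\<close>)
  thus ?thesis using i by simp
qed

text \<open>In each chart the function is a sum of products of the components of the anchored
  section, which are smooth because the anchor is a smooth bundle map, with partial derivatives of
  \<open>f\<close>.\<close>

lemma anchor_deriv_smooth:
  assumes V: "V \<in> sections L" and f: "f \<in> smooth_fns"
  shows "anchor_deriv V f \<in> smooth_fns"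
  unfolding smooth_functions_def mem_Collect_eq
proof (rule smooth_onI)
  fix U \<phi> assume a: "(U, \<phi>) \<in> atlas (base L)"
  let ?n = "mdim (base L)"
  note ch = smooth_manifold_chart[OF manifold a]
  let ?S = "\<phi> ` (U \<inter> UNIV)" and ?inv = "inv_into U \<phi>"
  have S: "openin (Euclidean_space ?n) ?S"
    by (rule openin_chart_image[OF ch open_UNIV])
  have f': "C_inf_on ?n ?S (f \<circ> ?inv)"
    using smooth_onD[OF _ a, of UNIV f] f unfolding smooth_functions_def o_def by blast
  have c: "C_inf_on ?n ?S (\<lambda>u. snd (anchor L (V (?inv u))) (\<lambda>y. \<phi> y i))" if "i < ?n" for i
    using smooth_onD[OF anchor_component_smooth[OF V a that] a] by simp
  show "C_inf_on ?n ?S (\<lambda>u. anchor_deriv V f (?inv u))"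
  proof (rule C_inf_on_cong[OF S])
    show "C_inf_on ?n ?S (\<lambda>u. \<Sum>i<?n. snd (anchor L (V (?inv u))) (\<lambda>y. \<phi> y i) *
        partial_deriv i (f \<circ> ?inv) u)"
      by (intro C_inf_on_sum C_inf_on_mult S c C_inf_on_partial_deriv f') auto
    fix u assume "u \<in> ?S"
    then obtain x where x: "x \<in> U" "u = \<phi> x" by blast
    show "(\<Sum>i<?n. snd (anchor L (V (?inv u))) (\<lambda>y. \<phi> y i) * partial_deriv i (f \<circ> ?inv) u) =
        anchor_deriv V f (?inv u)"
      using tangent_vector_in_chart[OF manifold anchor_tangent[OF V] a x(1) f]
      by (simp add: x chart_inv[OF ch] d_pair_def)
  qed
qed

subsection \<open>Forms and the Lie derivative\<close>

text \<open>The conditions of \<open>forms_deg\<close> imposed on lists of every length at once.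
  Inhomogeneous forms satisfy them too, so the identities can be proved without decomposing a form
  by degree.\<close>

definition alternating_form :: "('m, 'e) form \<Rightarrow> bool" where
  "alternating_form \<eta> \<longleftrightarrow>
     (\<forall>vs. \<not> set vs \<subseteq> sections L \<longrightarrow> \<eta> vs = (\<lambda>x. 0)) \<and>
     (\<forall>vs. set vs \<subseteq> sections L \<longrightarrow>
        \<eta> vs \<in> smooth_fns \<and>
        (\<forall>i < length vs. \<forall>s \<in> sections L. \<forall>t \<in> sections L.
           \<eta> (vs[i := sec_add L s t]) = (\<lambda>x. \<eta> (vs[i := s]) x + \<eta> (vs[i := t]) x)) \<and>
        (\<forall>i < length vs. \<forall>s \<in> sections L. \<forall>f \<in> smooth_fns.
           \<eta> (vs[i := sec_scale L f s]) = (\<lambda>x. f x * \<eta> (vs[i := s]) x)) \<and>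
        (\<forall>i < length vs. \<forall>j < length vs. i \<noteq> j \<longrightarrow>
           \<eta> (vs[i := vs ! j, j := vs ! i]) = (\<lambda>x. - \<eta> vs x)))"

lemma alternating_form_vanishes:
  "alternating_form \<eta> \<Longrightarrow> \<not> set vs \<subseteq> sections L \<Longrightarrow> \<eta> vs = (\<lambda>x. 0)"
  by (simp add: alternating_form_def)

lemma alternating_form_smooth:
  "alternating_form \<eta> \<Longrightarrow> set vs \<subseteq> sections L \<Longrightarrow> \<eta> vs \<in> smooth_fns"
  by (simp add: alternating_form_def)

lemma alternating_form_add:
  "alternating_form \<eta> \<Longrightarrow> set vs \<subseteq> sections L \<Longrightarrow> i < length vs \<Longrightarrow>
     s \<in> sections L \<Longrightarrow> t \<in> sections L \<Longrightarrow>
     \<eta> (vs[i := sec_add L s t]) x = \<eta> (vs[i := s]) x + \<eta> (vs[i := t]) x"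
  by (simp add: alternating_form_def)

lemma alternating_form_scale:
  "alternating_form \<eta> \<Longrightarrow> set vs \<subseteq> sections L \<Longrightarrow> i < length vs \<Longrightarrow>
     s \<in> sections L \<Longrightarrow> f \<in> smooth_fns \<Longrightarrow>
     \<eta> (vs[i := sec_scale L f s]) x = f x * \<eta> (vs[i := s]) x"
  by (simp add: alternating_form_def)

lemma alternating_form_swap:
  "alternating_form \<eta> \<Longrightarrow> set vs \<subseteq> sections L \<Longrightarrow> i < length vs \<Longrightarrow> j < length vs \<Longrightarrow>
     i \<noteq> j \<Longrightarrow> \<eta> (vs[i := vs ! j, j := vs ! i]) x = - \<eta> vs x"
  by (simp add: alternating_form_def)

lemma forms_deg_iff:
  "\<eta> \<in> forms_deg L p \<longleftrightarrow>
     alternating_form \<eta> \<and> (\<forall>vs. int (length vs) \<noteq> p \<longrightarrow> \<eta> vs = (\<lambda>x. 0))"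
proof
  assume \<eta>: "\<eta> \<in> forms_deg L p"
  hence off: "\<And>vs. \<not> (int (length vs) = p \<and> set vs \<subseteq> sections L) \<Longrightarrow> \<eta> vs = (\<lambda>x. 0)"
    unfolding forms_deg_def by blast
  have "alternating_form \<eta>"
    unfolding alternating_form_def
  proof (intro conjI allI impI)
    fix vs :: "('m \<Rightarrow> 'e) list" assume vs: "set vs \<subseteq> sections L"
    \<comment> \<open>Either the list has the length prescribed by the degree, and the definition
      applies, or \<open>\<eta>\<close> is zero on all lists of that length and the conditions hold
      trivially; updates preserve length.\<close>
    have *: "int (length vs) = p \<and> set vs \<subseteq> sections L \<or> (\<forall>ws. length ws = length vs \<longrightarrow> \<eta> ws = (\<lambda>x. 0))"
      using off vs by auto
    show "\<eta> vs \<in> smooth_fns"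
      using * \<eta> by (auto simp: forms_deg_def smooth_functions_const)
    show "\<forall>s\<in>sections L. \<forall>t\<in>sections L.
        \<eta> (vs[i := sec_add L s t]) = (\<lambda>x. \<eta> (vs[i := s]) x + \<eta> (vs[i := t]) x)"
      if "i < length vs" for i
      using * \<eta> that by (auto simp: forms_deg_def)
    show "\<forall>s\<in>sections L. \<forall>f\<in>smooth_fns.
        \<eta> (vs[i := sec_scale L f s]) = (\<lambda>x. f x * \<eta> (vs[i := s]) x)"
      if "i < length vs" for i
      using * \<eta> that by (auto simp: forms_deg_def)
    show "\<eta> (vs[i := vs ! j, j := vs ! i]) = (\<lambda>x. - \<eta> vs x)"
      if "i < length vs" "j < length vs" "i \<noteq> j" for i j
      using * \<eta> that by (auto simp: forms_deg_def)
  qed (use off in auto)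
  thus "alternating_form \<eta> \<and> (\<forall>vs. int (length vs) \<noteq> p \<longrightarrow> \<eta> vs = (\<lambda>x. 0))"
    using off by blast
qed (auto simp: forms_deg_def alternating_form_def)

text \<open>Each condition is stable under finite sums of forms, so it passes from the homogeneous
  components to their sum.\<close>

lemma forms_alternating:
  assumes "\<eta> \<in> forms L"
  shows "alternating_form \<eta>"
proof -
  obtain P :: "int set" and \<xi> where "finite P" "\<forall>p\<in>P. \<xi> p \<in> forms_deg L p"
      and \<eta>: "\<eta> = (\<lambda>vs x. \<Sum>p\<in>P. \<xi> p vs x)"
    using assms unfolding forms_def mem_Collect_eq by (elim exE conjE)
  hence P: "finite P" "\<And>p. p \<in> P \<Longrightarrow> alternating_form (\<xi> p)"
    by (simp_all add: forms_deg_iff)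
  note alt = alternating_form_vanishes[OF P(2)] alternating_form_smooth[OF P(2)]
    alternating_form_add[OF P(2)] alternating_form_scale[OF P(2)] alternating_form_swap[OF P(2)]
  show ?thesis
    unfolding \<eta> alternating_form_def
    by (intro conjI allI ballI impI smooth_sum P ext)
       (simp_all add: alt sum.distrib sum_distrib_left sum_negf cong: sum.cong)
qed

section \<open>Bracket identities seen through additive functionals\<close>

lemma bracket_Leibniz:
  "V \<in> sections L \<Longrightarrow> W \<in> sections L \<Longrightarrow> f \<in> smooth_fns \<Longrightarrow>
     bracket L V (sec_scale L f W) =
       sec_add L (sec_scale L f (bracket L V W)) (sec_scale L (anchor_deriv V f) W)"
  using lie_algebroid by (simp add: lie_algebroid_def)

lemma bracket_add:
  assumes "s \<in> sections L" "t \<in> sections L" "u \<in> sections L"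
  shows "bracket L (sec_add L s t) u = sec_add L (bracket L s u) (bracket L t u)"
    and "bracket L u (sec_add L s t) = sec_add L (bracket L u s) (bracket L u t)"
  using lie_algebroid assms unfolding lie_algebroid_def lie_algebra_bracket_def by blast+

lemma bracket_self: "s \<in> sections L \<Longrightarrow> bracket L s s = vzero L"
  using lie_algebroid by (simp add: lie_algebroid_def lie_algebra_bracket_def)

lemma bracket_cyclic:
  "s \<in> sections L \<Longrightarrow> t \<in> sections L \<Longrightarrow> u \<in> sections L \<Longrightarrow>
     sec_add L (bracket L s (bracket L t u))
       (sec_add L (bracket L t (bracket L u s)) (bracket L u (bracket L s t))) = vzero L"
  using lie_algebroid by (simp add: lie_algebroid_def lie_algebra_bracket_def)

text \<open>
  Identities between sections are tested against additive functionals, which avoids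
  computing with the fibrewise operations \<^const>\<open>sec_add\<close> and \<^const>\<open>vzero\<close>.
\<close>

lemma additive_bracket_antisym:
  fixes F :: "('m \<Rightarrow> 'e) \<Rightarrow> real"
  assumes F: "\<And>s t. s \<in> sections L \<Longrightarrow> t \<in> sections L \<Longrightarrow> F (sec_add L s t) = F s + F t"
    and s: "s \<in> sections L" "t \<in> sections L"
  shows "F (vzero L) = 0" and "F (bracket L s t) = - F (bracket L t s)"
proof -
  \<comment> \<open>The zero section is smooth because it is the bracket of a section with
    itself.\<close>
  have "vzero L \<in> sections L"
    using section_bracket[OF s(1) s(1)] by (simp add: bracket_self s)
  from F[OF this this] show F0: "F (vzero L) = 0"
    by (simp add: sec_add_vzero[OF vbundle])
  have st: "sec_add L s t \<in> sections L"
    by (rule section_add[OF s])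
  \<comment> \<open>Polarisation: expanding the bracket of \<open>s + t\<close> with itself leaves
    only the two mixed terms.\<close>
  have "0 = F (bracket L (sec_add L s t) (sec_add L s t))"
    using F0 by (simp add: bracket_self[OF st])
  also have "\<dots> = F (bracket L s s) + F (bracket L s t) + (F (bracket L t s) + F (bracket L t t))"
    by (simp add: bracket_add s st F section_bracket section_add)
  finally show "F (bracket L s t) = - F (bracket L t s)"
    using F0 by (simp add: bracket_self s)
qed

text \<open>The cyclic Jacobi identity, with two of its terms turned around by antisymmetry, in the
  form in which it says that bracketing with \<open>s\<close> is a derivation of the
  bracket.\<close>

lemma additive_bracket_Jacobi:
  fixes F :: "('m \<Rightarrow> 'e) \<Rightarrow> real"
  assumes F: "\<And>s t. s \<in> sections L \<Longrightarrow> t \<in> sections L \<Longrightarrow> F (sec_add L s t) = F s + F t"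
    and s: "s \<in> sections L" "t \<in> sections L" "u \<in> sections L"
  shows "F (bracket L (bracket L s t) u) =
    F (bracket L s (bracket L t u)) - F (bracket L t (bracket L s u))"
proof -
  have F0: "F (vzero L) = 0"
    by (rule additive_bracket_antisym(1)[of F, OF _ s(1,2)]) (rule F)
  have anti: "F (bracket L a b) = - F (bracket L b a)" if "a \<in> sections L" "b \<in> sections L" for a b
    by (rule additive_bracket_antisym(2)[of F, OF _ that]) (rule F)
  have "0 = F (bracket L s (bracket L t u)) + (F (bracket L t (bracket L u s)) +
      F (bracket L u (bracket L s t)))"
    using F0
    by (simp add: bracket_cyclic[OF s, symmetric] F section_bracket section_add s)
  moreover have "F (bracket L u (bracket L s t)) = - F (bracket L (bracket L s t) u)"
    by (intro anti section_bracket s)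
  \<comment> \<open>Antisymmetry is needed inside another bracket; it is applied to the functional
    that first brackets with \<open>t\<close>, which is again additive.\<close>
  moreover have "F (bracket L t (bracket L u s)) = - F (bracket L t (bracket L s u))"
    by (rule additive_bracket_antisym(2)[where F = "\<lambda>r. F (bracket L t r)"])
       (simp_all add: bracket_add F section_bracket s)
  ultimately show ?thesis by simp
qed

section \<open>The Lie derivative of an alternating form\<close>

lemma nth_section: "set vs \<subseteq> sections L \<Longrightarrow> i < length vs \<Longrightarrow> vs ! i \<in> sections L"
  using nth_mem by blast

lemma update_sections:
  "set vs \<subseteq> sections L \<Longrightarrow> w \<in> sections L \<Longrightarrow> set (vs[i := w]) \<subseteq> sections L"
  by (rule set_update_subsetI)

lemma lie_deriv_sections:
  "set vs \<subseteq> sections L \<Longrightarrow> lie_deriv L V \<eta> vs =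
     (\<lambda>x. anchor_deriv V (\<eta> vs) x - (\<Sum>i<length vs. \<eta> (vs[i := bracket L V (vs ! i)]) x))"
  by (simp add: lie_deriv_def)

lemma lie_deriv_vanishes: "\<not> set vs \<subseteq> sections L \<Longrightarrow> lie_deriv L V \<eta> vs = (\<lambda>x. 0)"
  by (simp add: lie_deriv_def)

text \<open>Slot \<open>i\<close> is separated from the others, and in the remaining terms its
  update is written last. The dependence on \<open>u\<close> is then visible term by term, which
  serves both multilinearity and iterated Lie derivatives.\<close>

lemma lie_deriv_update:
  assumes "set vs \<subseteq> sections L" "u \<in> sections L" "i < length vs"
  shows "lie_deriv L V \<eta> (vs[i := u]) x =
    anchor_deriv V (\<eta> (vs[i := u])) x -
    (\<Sum>k\<in>{..<length vs} - {i}. \<eta> (vs[k := bracket L V (vs ! k), i := u]) x) -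
    \<eta> (vs[i := bracket L V u]) x"
proof -
  have "(\<Sum>k<length vs. \<eta> (vs[i := u, k := bracket L V (vs[i := u] ! k)]) x) =
      \<eta> (vs[i := bracket L V u]) x +
      (\<Sum>k\<in>{..<length vs} - {i}. \<eta> (vs[i := u, k := bracket L V (vs[i := u] ! k)]) x)"
    using assms by (subst sum.remove[of _ i]) auto
  \<comment> \<open>Updates at distinct slots commute, and for \<open>k\<close> other than
    \<open>i\<close> the entry read at \<open>k\<close> is still the original one.\<close>
  also have "(\<Sum>k\<in>{..<length vs} - {i}. \<eta> (vs[i := u, k := bracket L V (vs[i := u] ! k)]) x) =
      (\<Sum>k\<in>{..<length vs} - {i}. \<eta> (vs[k := bracket L V (vs ! k), i := u]) x)"
    by (intro sum.cong refl) (auto simp: list_update_swap)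
  finally show ?thesis
    using assms by (simp add: lie_deriv_sections update_sections)
qed

text \<open>Additivity is inherited term by term; linearity over smooth functions needs a
  cancellation of two derivative terms; skew-symmetry follows by exchanging the two slots in the sum
  of bracket terms as well. Iterated Lie derivatives and preservation of degree rest on
  this.\<close>

lemma lie_deriv_alternating:
  assumes V: "V \<in> sections L" and \<eta>: "alternating_form \<eta>"
  shows "alternating_form (lie_deriv L V \<eta>)"
  unfolding alternating_form_def
proof (intro conjI allI impI ballI)
  fix vs :: "('m \<Rightarrow> 'e) list"
  assume "\<not> set vs \<subseteq> sections L"
  thus "lie_deriv L V \<eta> vs = (\<lambda>x. 0)" by (rule lie_deriv_vanishes)
next
  fix vs assume vs: "set vs \<subseteq> sections L"
  note sm = alternating_form_smooth[OF \<eta>]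
  have upd: "set (vs[k := bracket L V (vs ! k)]) \<subseteq> sections L" if "k < length vs" for k
    using vs V that by (intro update_sections section_bracket nth_section)
  show "lie_deriv L V \<eta> vs \<in> smooth_fns"
    unfolding lie_deriv_sections[OF vs]
    using upd by (intro smooth_diff smooth_sum anchor_deriv_smooth V sm vs) auto
  {
    fix i s t assume i: "i < length vs" and s: "s \<in> sections L" "t \<in> sections L"
    have D: "anchor_deriv V (\<eta> (vs[i := sec_add L s t])) x =
        anchor_deriv V (\<eta> (vs[i := s])) x + anchor_deriv V (\<eta> (vs[i := t])) x" for x
    proof -
      have "\<eta> (vs[i := sec_add L s t]) = (\<lambda>x. \<eta> (vs[i := s]) x + \<eta> (vs[i := t]) x)"
        by (rule ext) (rule alternating_form_add[OF \<eta> vs i s])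
      thus ?thesis
        by (simp add: anchor_deriv_add V sm update_sections[OF vs] s)
    qed
    have "(\<Sum>k\<in>{..<length vs} - {i}. \<eta> (vs[k := bracket L V (vs ! k), i := sec_add L s t]) x) =
        (\<Sum>k\<in>{..<length vs} - {i}. \<eta> (vs[k := bracket L V (vs ! k), i := s]) x) +
        (\<Sum>k\<in>{..<length vs} - {i}. \<eta> (vs[k := bracket L V (vs ! k), i := t]) x)" for x
      unfolding sum.distrib[symmetric]
      by (intro sum.cong refl alternating_form_add[OF \<eta> upd] s) (use i in auto)
    thus "lie_deriv L V \<eta> (vs[i := sec_add L s t]) =
        (\<lambda>x. lie_deriv L V \<eta> (vs[i := s]) x + lie_deriv L V \<eta> (vs[i := t]) x)"
      using i s V
      by (intro ext)
         (simp add: lie_deriv_update vs section_add D bracket_add section_bracket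
           alternating_form_add[OF \<eta>])
  }
  {
    fix i s f assume i: "i < length vs" and s: "s \<in> sections L" and f: "f \<in> smooth_fns"
    have D: "anchor_deriv V (\<eta> (vs[i := sec_scale L f s])) x =
        anchor_deriv V f x * \<eta> (vs[i := s]) x + f x * anchor_deriv V (\<eta> (vs[i := s])) x" for x
    proof -
      have "\<eta> (vs[i := sec_scale L f s]) = (\<lambda>x. f x * \<eta> (vs[i := s]) x)"
        by (rule ext) (rule alternating_form_scale[OF \<eta> vs i s f])
      thus ?thesis
        by (simp add: anchor_deriv_mult V sm update_sections[OF vs] s f)
    qed
    have "(\<Sum>k\<in>{..<length vs} - {i}. \<eta> (vs[k := bracket L V (vs ! k), i := sec_scale L f s]) x) =
        f x * (\<Sum>k\<in>{..<length vs} - {i}. \<eta> (vs[k := bracket L V (vs ! k), i := s]) x)" for x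
      unfolding sum_distrib_left
      by (intro sum.cong refl alternating_form_scale[OF \<eta> upd] s f) (use i in auto)
    \<comment> \<open>The derivative of \<open>f\<close> produced here by the Leibniz rule of the
      bracket cancels the one produced in \<open>D\<close> by the product rule for the anchor
      action.\<close>
    moreover have "\<eta> (vs[i := bracket L V (sec_scale L f s)]) x =
        f x * \<eta> (vs[i := bracket L V s]) x + anchor_deriv V f x * \<eta> (vs[i := s]) x" for x
      by (simp add: bracket_Leibniz V s f alternating_form_add[OF \<eta> vs i]
          alternating_form_scale[OF \<eta> vs i] section_scale section_bracket anchor_deriv_smooth)
    ultimately show "lie_deriv L V \<eta> (vs[i := sec_scale L f s]) =
        (\<lambda>x. f x * lie_deriv L V \<eta> (vs[i := s]) x)"
      by (intro ext)
         (simp add: lie_deriv_update[OF vs _ i] section_scale s f D right_diff_distrib)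
  }
  {
    fix i j assume i: "i < length vs" and j: "j < length vs" and ij: "i \<noteq> j"
    define sw where "sw ws = ws[i := ws ! j, j := ws ! i]" for ws :: "('m \<Rightarrow> 'e) list"
    have sw: "\<eta> (sw ws) x = - \<eta> ws x" if "set ws \<subseteq> sections L" "length ws = length vs" for ws x
      unfolding sw_def using alternating_form_swap[OF \<eta>] that i j ij by simp
    \<comment> \<open>Exchanging entries carries an update at slot \<open>k\<close> to one at the
      transposed slot, so the sum over slots is merely reindexed by an involution.\<close>
    have "(sw vs)[k := w] = sw (vs[Transposition.transpose i j k := w])" if "k < length vs" for k w
      unfolding sw_def using i j ij that
      by (intro nth_equalityI) (auto simp: nth_list_update Transposition.transpose_def)
    moreover have "sw vs ! k = vs ! Transposition.transpose i j k" if "k < length vs" for k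
      unfolding sw_def using i j ij that by (auto simp: nth_list_update Transposition.transpose_def)
    ultimately have "(\<Sum>k<length vs. \<eta> ((sw vs)[k := bracket L V (sw vs ! k)]) x) =
        (\<Sum>k<length vs. \<eta> (sw (vs[Transposition.transpose i j k := bracket L V (vs ! Transposition.transpose i j k)])) x)" for x
      by simp
    also have "\<dots> x = (\<Sum>k<length vs. \<eta> (sw (vs[k := bracket L V (vs ! k)])) x)" for x
      by (rule sum.reindex_bij_witness[of _ "Transposition.transpose i j" "Transposition.transpose i j"])
         (use i j in \<open>auto simp: Transposition.transpose_def\<close>)
    also have "\<dots> x = - (\<Sum>k<length vs. \<eta> (vs[k := bracket L V (vs ! k)]) x)" for x
      by (simp add: sw upd sum_negf)
    finally have S: "(\<Sum>k<length vs. \<eta> ((sw vs)[k := bracket L V (sw vs ! k)]) x) =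
        - (\<Sum>k<length vs. \<eta> (vs[k := bracket L V (vs ! k)]) x)" for x .
    have sw_sub: "set (sw vs) \<subseteq> sections L"
      unfolding sw_def using vs i j by (intro update_sections nth_section)
    have "\<eta> (sw vs) = (\<lambda>x. - \<eta> vs x)"
      using sw[OF vs refl] by blast
    hence "lie_deriv L V \<eta> (sw vs) = (\<lambda>x. - lie_deriv L V \<eta> vs x)"
      using S
      by (simp add: lie_deriv_sections vs sw_sub anchor_deriv_uminus V sm) (simp add: sw_def)
    thus "lie_deriv L V \<eta> (vs[i := vs ! j, j := vs ! i]) = (\<lambda>x. - lie_deriv L V \<eta> vs x)"
      by (simp add: sw_def)
  }
qed

text \<open>The Lie derivative evaluates \<open>\<eta>\<close> only on lists of the same length, so
  in every other degree it is built from zero functions.\<close>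

lemma lie_deriv_degree:
  assumes "V \<in> sections L" "\<eta> \<in> forms_deg L p"
  shows "lie_deriv L V \<eta> \<in> forms_deg L p"
proof -
  have "lie_deriv L V \<eta> vs = (\<lambda>x. 0)" if "int (length vs) \<noteq> p" for vs
    using assms that unfolding forms_deg_iff
    by (cases "set vs \<subseteq> sections L")
       (simp_all add: lie_deriv_sections lie_deriv_vanishes anchor_deriv_const)
  thus ?thesis
    using assms lie_deriv_alternating by (simp add: forms_deg_iff)
qed

section \<open>Compatibility with the differential and the interior product\<close>

text \<open>On a single section \<open>W\<close> this is the statement that the anchor represents
  the bracket: V(W f) minus {V,W} f equals W(V f). On every other list both sides vanish.\<close>

lemma lie_deriv_d_rho:
  assumes V: "V \<in> sections L" and f: "f \<in> smooth_fns"
  shows "lie_deriv L V (d_rho L f) = d_rho L (lie_deriv L V (fun_form f) [])"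
proof
  fix vs
  have *: "lie_deriv L V (fun_form f) [] = anchor_deriv V f"
    by (simp add: lie_deriv_def fun_form_def)
  show "lie_deriv L V (d_rho L f) vs = d_rho L (lie_deriv L V (fun_form f) []) vs"
  proof (cases "set vs \<subseteq> sections L \<and> length vs = 1")
    case True
    then obtain W where "vs = [W]" "W \<in> sections L"
      by (cases vs) auto
    thus ?thesis
      unfolding *
      by (simp add: lie_deriv_sections d_rho_def section_bracket V anchor_deriv_bracket f)
  next
    case False
    thus ?thesis
      unfolding *
      by (cases "set vs \<subseteq> sections L")
         (auto simp: lie_deriv_sections lie_deriv_vanishes d_rho_def anchor_deriv_const V)
  qed
qed

lemma int_prod_bracket:
  assumes V: "V \<in> sections L" and W: "W \<in> sections L" and \<eta>: "alternating_form \<eta>"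
  shows "int_prod (bracket L V W) \<eta> =
    form_diff (lie_deriv L V (int_prod W \<eta>)) (int_prod W (lie_deriv L V \<eta>))"
proof (intro ext)
  fix vs x
  show "int_prod (bracket L V W) \<eta> vs x =
      form_diff (lie_deriv L V (int_prod W \<eta>)) (int_prod W (lie_deriv L V \<eta>)) vs x"
  proof (cases "set vs \<subseteq> sections L")
    case True
    \<comment> \<open>Evaluating the Lie derivative of \<open>\<eta>\<close> on
      \<open>W # vs\<close>, the term of slot 0 contains the bracket of \<open>V\<close> and
      \<open>W\<close>; the other terms are those of the Lie derivative of the contracted
      form.\<close>
    thus ?thesis
      using W by (simp add: int_prod_def form_diff_def lie_deriv_sections sum.lessThan_Suc_shift
          del: sum.lessThan_Suc)
  next
    case False
    thus ?thesis
      by (simp add: int_prod_def form_diff_def lie_deriv_vanishes alternating_form_vanishes[OF \<eta>])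
  qed
qed

section \<open>Derivation property\<close>

lemma lie_deriv_form_add:
  assumes V: "V \<in> sections L" and \<eta>: "alternating_form \<eta>" and \<zeta>: "alternating_form \<zeta>"
  shows "lie_deriv L V (form_add \<eta> \<zeta>) = form_add (lie_deriv L V \<eta>) (lie_deriv L V \<zeta>)"
proof
  fix vs
  show "lie_deriv L V (form_add \<eta> \<zeta>) vs = form_add (lie_deriv L V \<eta>) (lie_deriv L V \<zeta>) vs"
    by (cases "set vs \<subseteq> sections L")
       (auto simp: form_add_def lie_deriv_sections lie_deriv_vanishes sum.distrib
         anchor_deriv_add[OF V alternating_form_smooth[OF \<eta>] alternating_form_smooth[OF \<zeta>]])
qed

lemma lie_deriv_form_scale:
  assumes V: "V \<in> sections L" and \<eta>: "alternating_form \<eta>"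
  shows "lie_deriv L V (form_scale (\<lambda>x. c) \<eta>) = form_scale (\<lambda>x. c) (lie_deriv L V \<eta>)"
proof
  fix vs
  show "lie_deriv L V (form_scale (\<lambda>x. c) \<eta>) vs = form_scale (\<lambda>x. c) (lie_deriv L V \<eta>) vs"
    by (cases "set vs \<subseteq> sections L")
       (auto simp: form_scale_def lie_deriv_sections lie_deriv_vanishes right_diff_distrib
         sum_distrib_left anchor_deriv_scale[OF V alternating_form_smooth[OF \<eta>]])
qed

text \<open>On a given list \<open>wedge\<close> sums over all splittings, so inhomogeneous forms
  are handled directly. The identity is reduced to one for each splitting point and each shuffle
  separately.\<close>

lemma lie_deriv_wedge:
  assumes V: "V \<in> sections L" and \<xi>: "alternating_form \<xi>" and \<eta>: "alternating_form \<eta>"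
  shows "lie_deriv L V (wedge \<xi> \<eta>) =
    form_add (wedge (lie_deriv L V \<xi>) \<eta>) (wedge \<xi> (lie_deriv L V \<eta>))"
proof (intro ext)
  fix vs x
  note off = alternating_form_vanishes[OF \<xi>] alternating_form_vanishes[OF \<eta>] lie_deriv_vanishes
  note sm = alternating_form_smooth[OF \<xi>] alternating_form_smooth[OF \<eta>]
  show "lie_deriv L V (wedge \<xi> \<eta>) vs x =
      form_add (wedge (lie_deriv L V \<xi>) \<eta>) (wedge \<xi> (lie_deriv L V \<eta>)) vs x"
  proof (cases "set vs \<subseteq> sections L")
    case False
    thus ?thesis
      using wedge_vanishes[OF off(1) off(3) False] wedge_vanishes[OF off(3) off(2) False]
      by (simp add: form_add_def lie_deriv_vanishes)
  next
    case True
    define n where "n = length vs"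
    \<comment> \<open>\<open>A\<close> and \<open>B\<close> are the arguments that a shuffle hands
      to the first and the second factor; \<open>ws k\<close> is the argument list with
      \<open>V\<close> bracketed into slot \<open>k\<close>.\<close>
    define A where "A ws p \<sigma> = map (\<lambda>i. ws ! \<sigma> i) [0..<p]" for ws :: "('m \<Rightarrow> 'e) list" and p \<sigma>
    define B where "B ws p \<sigma> = map (\<lambda>i. ws ! \<sigma> i) [p..<n]" for ws :: "('m \<Rightarrow> 'e) list" and p \<sigma>
    define ws where "ws k = vs[k := bracket L V (vs ! k)]" for k
    let ?P = "\<lambda>p. perm_shuffles p (n - p)"
    have wedge: "wedge \<alpha> \<beta> us = (\<lambda>x. \<Sum>p\<le>n. \<Sum>\<sigma>\<in>?P p. of_int (sign \<sigma>) * (\<alpha> (A us p \<sigma>) x * \<beta> (B us p \<sigma>) x))"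
      if "length us = n" for \<alpha> \<beta> :: "('m, 'e) form" and us
      unfolding wedge_def that A_def B_def by (simp add: mult.assoc)
    have perm: "\<sigma> permutes {..<n}" if "p \<le> n" "\<sigma> \<in> ?P p" for p \<sigma>
      using that by (simp add: perm_shuffles_def)
    have A_sub: "set (A vs p \<sigma>) \<subseteq> sections L" and B_sub: "set (B vs p \<sigma>) \<subseteq> sections L"
      if "p \<le> n" "\<sigma> \<in> ?P p" for p \<sigma>
      using permuted_sublist_subset[of \<sigma> vs "sections L"] perm[OF that] that True
      unfolding A_def B_def n_def by blast+
    have core: "(\<Sum>k<n. \<xi> (A (ws k) p \<sigma>) x * \<eta> (B (ws k) p \<sigma>) x) =
        (\<Sum>m<p. \<xi> ((A vs p \<sigma>)[m := bracket L V (A vs p \<sigma> ! m)]) x) * \<eta> (B vs p \<sigma>) x +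
        \<xi> (A vs p \<sigma>) x * (\<Sum>m<n - p. \<eta> ((B vs p \<sigma>)[m := bracket L V (B vs p \<sigma> ! m)]) x)"
      if p: "p \<le> n" and \<sigma>: "\<sigma> \<in> ?P p" for p \<sigma>
    proof -
      define q where "q = n - p"
      have n: "n = p + q" "length vs = p + q" using p by (simp_all add: q_def n_def)
      have \<sigma>': "\<sigma> permutes {..<p + q}" using perm[OF p \<sigma>] n by simp
      have 1: "\<xi> (A (ws (\<sigma> m)) p \<sigma>) x * \<eta> (B (ws (\<sigma> m)) p \<sigma>) x =
          \<xi> ((A vs p \<sigma>)[m := bracket L V (A vs p \<sigma> ! m)]) x * \<eta> (B vs p \<sigma>) x" if "m < p" for m
      proof -
        have "A (ws (\<sigma> m)) p \<sigma> = (A vs p \<sigma>)[m := bracket L V (vs ! \<sigma> m)]"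
          unfolding A_def B_def ws_def n(1) by (rule shuffle_update_left(1)[OF \<sigma>' n(2) that])
        moreover have "B (ws (\<sigma> m)) p \<sigma> = B vs p \<sigma>"
          unfolding A_def B_def ws_def n(1) by (rule shuffle_update_left(2)[OF \<sigma>' n(2) that])
        moreover have "A vs p \<sigma> ! m = vs ! \<sigma> m"
          using that by (simp add: A_def B_def n(1) del: upt_Suc)
        ultimately show ?thesis by simp
      qed
      have 2: "\<xi> (A (ws (\<sigma> (p + m))) p \<sigma>) x * \<eta> (B (ws (\<sigma> (p + m))) p \<sigma>) x =
          \<xi> (A vs p \<sigma>) x * \<eta> ((B vs p \<sigma>)[m := bracket L V (B vs p \<sigma> ! m)]) x" if "m < q" for m
      proof -
        have "B (ws (\<sigma> (p + m))) p \<sigma> = (B vs p \<sigma>)[m := bracket L V (vs ! \<sigma> (p + m))]"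
          unfolding A_def B_def ws_def n(1) by (rule shuffle_update_right(1)[OF \<sigma>' n(2) that])
        moreover have "A (ws (\<sigma> (p + m))) p \<sigma> = A vs p \<sigma>"
          unfolding A_def B_def ws_def n(1) by (rule shuffle_update_right(2)[OF \<sigma>' n(2) that])
        moreover have "B vs p \<sigma> ! m = vs ! \<sigma> (p + m)"
          using that by (simp add: A_def B_def n(1) del: upt_Suc)
        ultimately show ?thesis by simp
      qed
      \<comment> \<open>Reindexing slots by \<open>\<sigma>\<close> makes indices below
        \<open>p\<close> address the first factor and the remaining ones the second.\<close>
      have "(\<Sum>k<n. \<xi> (A (ws k) p \<sigma>) x * \<eta> (B (ws k) p \<sigma>) x) =
          (\<Sum>k<p + q. \<xi> (A (ws (\<sigma> k)) p \<sigma>) x * \<eta> (B (ws (\<sigma> k)) p \<sigma>) x)"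
        using sum.permute[OF \<sigma>', of "\<lambda>k. \<xi> (A (ws k) p \<sigma>) x * \<eta> (B (ws k) p \<sigma>) x"] n(1)
        by (simp add: o_def)
      also have "\<dots> = (\<Sum>m<p. \<xi> ((A vs p \<sigma>)[m := bracket L V (A vs p \<sigma> ! m)]) x * \<eta> (B vs p \<sigma>) x) +
          (\<Sum>m<q. \<xi> (A vs p \<sigma>) x * \<eta> ((B vs p \<sigma>)[m := bracket L V (B vs p \<sigma> ! m)]) x)"
        unfolding sum_lessThan_plus by (intro arg_cong2[of _ _ _ _ "(+)"] sum.cong refl) (simp_all add: 1 2)
      finally show ?thesis
        by (simp add: sum_distrib_left sum_distrib_right q_def)
    qed
    let ?t = "\<lambda>p \<sigma> x. of_int (sign \<sigma>) * (\<xi> (A vs p \<sigma>) x * \<eta> (B vs p \<sigma>) x)"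
    have sm': "\<xi> (A vs p \<sigma>) \<in> smooth_fns" "\<eta> (B vs p \<sigma>) \<in> smooth_fns" "?t p \<sigma> \<in> smooth_fns"
      if "p \<le> n" "\<sigma> \<in> ?P p" for p \<sigma>
      using sm A_sub[OF that] B_sub[OF that]
      by (auto intro!: smooth_mult smooth_functions_const)
    \<comment> \<open>The anchor action passes through both finite sums and then obeys the product
      rule; each step requires the smoothness recorded in \<open>sm'\<close>.\<close>
    have D: "anchor_deriv V (wedge \<xi> \<eta> vs) x = (\<Sum>p\<le>n. \<Sum>\<sigma>\<in>?P p. of_int (sign \<sigma>) *
        (anchor_deriv V (\<xi> (A vs p \<sigma>)) x * \<eta> (B vs p \<sigma>) x +
         \<xi> (A vs p \<sigma>) x * anchor_deriv V (\<eta> (B vs p \<sigma>)) x))"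
    proof -
      have "anchor_deriv V (wedge \<xi> \<eta> vs) = (\<lambda>x. \<Sum>p\<le>n. anchor_deriv V (\<lambda>x. \<Sum>\<sigma>\<in>?P p. ?t p \<sigma> x) x)"
        unfolding wedge[OF n_def[symmetric]]
        using sm'(3) by (intro anchor_deriv_sum V smooth_sum finite_perm_shuffles) auto
      also have "\<dots> = (\<lambda>x. \<Sum>p\<le>n. \<Sum>\<sigma>\<in>?P p. anchor_deriv V (?t p \<sigma>) x)"
        using sm'(3) by (intro ext sum.cong refl fun_cong[OF anchor_deriv_sum] V finite_perm_shuffles) auto
      also have "\<dots> = (\<lambda>x. \<Sum>p\<le>n. \<Sum>\<sigma>\<in>?P p. of_int (sign \<sigma>) *
        (anchor_deriv V (\<xi> (A vs p \<sigma>)) x * \<eta> (B vs p \<sigma>) x +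
         \<xi> (A vs p \<sigma>) x * anchor_deriv V (\<eta> (B vs p \<sigma>)) x))"
        using sm' by (intro ext sum.cong refl)
          (simp add: anchor_deriv_scale[OF V smooth_mult] anchor_deriv_mult[OF V])
      finally show ?thesis by simp
    qed
    have "(\<Sum>k<n. wedge \<xi> \<eta> (ws k) x) =
        (\<Sum>k<n. \<Sum>p\<le>n. \<Sum>\<sigma>\<in>?P p. of_int (sign \<sigma>) * (\<xi> (A (ws k) p \<sigma>) x * \<eta> (B (ws k) p \<sigma>) x))"
      by (simp add: wedge ws_def n_def)
    also have "\<dots> = (\<Sum>p\<le>n. \<Sum>\<sigma>\<in>?P p. of_int (sign \<sigma>) *
        (\<Sum>k<n. \<xi> (A (ws k) p \<sigma>) x * \<eta> (B (ws k) p \<sigma>) x))"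
      by (subst sum.swap, intro sum.cong refl, subst sum.swap) (simp add: sum_distrib_left)
    finally have "lie_deriv L V (wedge \<xi> \<eta>) vs x = (\<Sum>p\<le>n. \<Sum>\<sigma>\<in>?P p. of_int (sign \<sigma>) *
        (anchor_deriv V (\<xi> (A vs p \<sigma>)) x * \<eta> (B vs p \<sigma>) x +
         \<xi> (A vs p \<sigma>) x * anchor_deriv V (\<eta> (B vs p \<sigma>)) x -
         (\<Sum>k<n. \<xi> (A (ws k) p \<sigma>) x * \<eta> (B (ws k) p \<sigma>) x)))"
      by (simp add: lie_deriv_sections[OF True] D n_def[symmetric] ws_def[symmetric]
          sum_subtractf right_diff_distrib)
    also have "\<dots> = (\<Sum>p\<le>n. \<Sum>\<sigma>\<in>?P p. of_int (sign \<sigma>) *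
        (lie_deriv L V \<xi> (A vs p \<sigma>) x * \<eta> (B vs p \<sigma>) x +
         \<xi> (A vs p \<sigma>) x * lie_deriv L V \<eta> (B vs p \<sigma>) x))"
    proof (intro sum.cong refl arg_cong2[of _ _ _ _ "(*)"])
      fix p \<sigma> assume "p \<in> {..n}" and \<sigma>: "\<sigma> \<in> ?P p"
      hence p: "p \<le> n" by simp
      have len: "length (A vs p \<sigma>) = p" "length (B vs p \<sigma>) = n - p"
        by (simp_all add: A_def B_def)
      show "anchor_deriv V (\<xi> (A vs p \<sigma>)) x * \<eta> (B vs p \<sigma>) x +
         \<xi> (A vs p \<sigma>) x * anchor_deriv V (\<eta> (B vs p \<sigma>)) x -
         (\<Sum>k<n. \<xi> (A (ws k) p \<sigma>) x * \<eta> (B (ws k) p \<sigma>) x) =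
         lie_deriv L V \<xi> (A vs p \<sigma>) x * \<eta> (B vs p \<sigma>) x +
         \<xi> (A vs p \<sigma>) x * lie_deriv L V \<eta> (B vs p \<sigma>) x"
        unfolding core[OF p \<sigma>] lie_deriv_sections[OF A_sub[OF p \<sigma>]]
          lie_deriv_sections[OF B_sub[OF p \<sigma>]] len
        by (simp add: algebra_simps)
    qed
    also have "\<dots> = form_add (wedge (lie_deriv L V \<xi>) \<eta>) (wedge \<xi> (lie_deriv L V \<eta>)) vs x"
      by (simp add: form_add_def wedge n_def[symmetric] ring_distribs sum.distrib)
    finally show ?thesis .
  qed
qed

section \<open>Commutator of Lie derivatives\<close>

text \<open>Expanded so that the commutator can be read off: interchanging \<open>V\<close> and
  \<open>W\<close> swaps the two single sums of derivatives and preserves the off-diagonal double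
  sum. Only the first and the last term contribute.\<close>

lemma lie_deriv_lie_deriv:
  assumes V: "V \<in> sections L" and W: "W \<in> sections L" and \<eta>: "alternating_form \<eta>"
    and vs: "set vs \<subseteq> sections L"
  shows "lie_deriv L V (lie_deriv L W \<eta>) vs x =
    anchor_deriv V (anchor_deriv W (\<eta> vs)) x -
    (\<Sum>i<length vs. anchor_deriv V (\<eta> (vs[i := bracket L W (vs ! i)])) x) -
    (\<Sum>i<length vs. anchor_deriv W (\<eta> (vs[i := bracket L V (vs ! i)])) x) +
    (\<Sum>i<length vs. \<Sum>k\<in>{..<length vs} - {i}.
       \<eta> (vs[k := bracket L W (vs ! k), i := bracket L V (vs ! i)]) x) +
    (\<Sum>i<length vs. \<eta> (vs[i := bracket L W (bracket L V (vs ! i))]) x)"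
proof -
  have sm: "\<eta> (vs[k := bracket L U (vs ! k)]) \<in> smooth_fns"
    if "k < length vs" "U \<in> sections L" for k U
    using vs that by (intro alternating_form_smooth[OF \<eta>] update_sections section_bracket nth_section)
  have "anchor_deriv V (lie_deriv L W \<eta> vs) x = anchor_deriv V (anchor_deriv W (\<eta> vs)) x -
      (\<Sum>i<length vs. anchor_deriv V (\<eta> (vs[i := bracket L W (vs ! i)])) x)"
  proof -
    have "(\<lambda>x. \<Sum>i<length vs. \<eta> (vs[i := bracket L W (vs ! i)]) x) \<in> smooth_fns"
      by (intro smooth_sum sm W) auto
    moreover have "anchor_deriv V (\<lambda>x. \<Sum>i<length vs. \<eta> (vs[i := bracket L W (vs ! i)]) x) =
        (\<lambda>x. \<Sum>i<length vs. anchor_deriv V (\<eta> (vs[i := bracket L W (vs ! i)])) x)"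
      by (intro anchor_deriv_sum V sm W) auto
    ultimately show ?thesis
      unfolding lie_deriv_sections[OF vs]
      using anchor_deriv_diff[OF V anchor_deriv_smooth[OF W alternating_form_smooth[OF \<eta> vs]]]
      by simp
  qed
  moreover have "(\<Sum>i<length vs. lie_deriv L W \<eta> (vs[i := bracket L V (vs ! i)]) x) =
      (\<Sum>i<length vs. anchor_deriv W (\<eta> (vs[i := bracket L V (vs ! i)])) x) -
      (\<Sum>i<length vs. \<Sum>k\<in>{..<length vs} - {i}.
         \<eta> (vs[k := bracket L W (vs ! k), i := bracket L V (vs ! i)]) x) -
      (\<Sum>i<length vs. \<eta> (vs[i := bracket L W (bracket L V (vs ! i))]) x)"
    by (simp add: lie_deriv_update vs V section_bracket nth_section sum_subtractf)
  ultimately show ?thesis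
    by (simp add: lie_deriv_sections[OF vs, of V "lie_deriv L W \<eta>"])
qed

lemma lie_deriv_bracket:
  assumes V: "V \<in> sections L" and W: "W \<in> sections L" and \<eta>: "alternating_form \<eta>"
  shows "lie_deriv L (bracket L V W) \<eta> =
    form_diff (lie_deriv L V (lie_deriv L W \<eta>)) (lie_deriv L W (lie_deriv L V \<eta>))"
proof (intro ext)
  fix vs x
  show "lie_deriv L (bracket L V W) \<eta> vs x =
      form_diff (lie_deriv L V (lie_deriv L W \<eta>)) (lie_deriv L W (lie_deriv L V \<eta>)) vs x"
  proof (cases "set vs \<subseteq> sections L")
    case False
    thus ?thesis by (simp add: form_diff_def lie_deriv_vanishes)
  next
    case True
    \<comment> \<open>The Jacobi identity in slot \<open>i\<close>, tested by the additive
      functional that evaluates \<open>\<eta>\<close> at \<open>x\<close> with the other entries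
      fixed.\<close>
    have "\<eta> (vs[i := bracket L (bracket L V W) (vs ! i)]) x =
        \<eta> (vs[i := bracket L V (bracket L W (vs ! i))]) x -
        \<eta> (vs[i := bracket L W (bracket L V (vs ! i))]) x" if "i < length vs" for i
      using additive_bracket_Jacobi[where F = "\<lambda>s. \<eta> (vs[i := s]) x"]
        alternating_form_add[OF \<eta> True that] V W nth_section[OF True that] by blast
    hence "(\<Sum>i<length vs. \<eta> (vs[i := bracket L (bracket L V W) (vs ! i)]) x) =
        (\<Sum>i<length vs. \<eta> (vs[i := bracket L V (bracket L W (vs ! i))]) x) -
        (\<Sum>i<length vs. \<eta> (vs[i := bracket L W (bracket L V (vs ! i))]) x)"
      by (simp add: sum_subtractf)
    moreover have "(\<Sum>i<length vs. \<Sum>k\<in>{..<length vs} - {i}.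
          \<eta> (vs[k := bracket L W (vs ! k), i := bracket L V (vs ! i)]) x) =
        (\<Sum>i<length vs. \<Sum>k\<in>{..<length vs} - {i}.
          \<eta> (vs[k := bracket L V (vs ! k), i := bracket L W (vs ! i)]) x)"
      by (subst sum_off_diagonal_swap) (auto intro!: sum.cong simp: list_update_swap)
    moreover have "anchor_deriv (bracket L V W) (\<eta> vs) x =
        anchor_deriv V (anchor_deriv W (\<eta> vs)) x - anchor_deriv W (anchor_deriv V (\<eta> vs)) x"
      by (simp add: anchor_deriv_bracket V W alternating_form_smooth[OF \<eta> True])
    ultimately show ?thesis
      unfolding form_diff_def lie_deriv_lie_deriv[OF V W \<eta> True] lie_deriv_lie_deriv[OF W V \<eta> True]
        lie_deriv_sections[OF True, of "bracket L V W"]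
      by simp
  qed
qed

section \<open>Lie derivative along a multiple of a section\<close>

text \<open>Induction over products of transpositions, each contributing a factor -1. The list is
  kept arbitrary because a transposition composed on the left is absorbed into it by exchanging two
  entries.\<close>

lemma alternating_form_permute:
  assumes \<eta>: "alternating_form \<eta>" and \<sigma>: "\<sigma> permutes {..<n}"
  shows "length vs = n \<Longrightarrow> set vs \<subseteq> sections L \<Longrightarrow>
    \<eta> (map (\<lambda>i. vs ! \<sigma> i) [0..<n]) x = of_int (sign \<sigma>) * \<eta> vs x"
  using \<sigma> finite_lessThan[of n]
proof (induction \<sigma> arbitrary: vs rule: permutes_induct)
  case id
  have "map (\<lambda>i. vs ! id i) [0..<n] = vs" using map_nth[of vs] id by simp
  thus ?case by simp
next
  case (swap a b p)
  define us where "us = vs[a := vs ! b, b := vs ! a]"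
  have ab: "a < length vs" "b < length vs" "a \<noteq> b" using swap by auto
  have lt: "p i < n" if "i < n" for i
    using permutes_in_image[OF \<open>p permutes {..<n}\<close>, of i] that by simp
  have "map (\<lambda>i. vs ! (Transposition.transpose a b \<circ> p) i) [0..<n] = map (\<lambda>i. us ! p i) [0..<n]"
    using ab lt swap.prems by (auto simp: us_def nth_list_update Transposition.transpose_def)
  hence "\<eta> (map (\<lambda>i. vs ! (Transposition.transpose a b \<circ> p) i) [0..<n]) x = of_int (sign p) * \<eta> us x"
  proof -
    have "length us = n" "set us \<subseteq> sections L"
      using swap.prems ab by (simp_all add: us_def update_sections nth_section)
    thus ?thesis using swap.IH[of us] \<open>map _ _ = map _ _\<close> by (simp only:)
  qed
  also have "\<eta> us x = - \<eta> vs x"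
    unfolding us_def using alternating_form_swap[OF \<eta>] swap.prems ab by blast
  finally have 1: "\<eta> (map (\<lambda>i. vs ! (Transposition.transpose a b \<circ> p) i) [0..<n]) x =
      - of_int (sign p) * \<eta> vs x" by simp
  have 2: "sign (Transposition.transpose a b \<circ> p) = - sign p"
    using ab sign_compose[OF permutation_swap_id permutation_permutes[THEN iffD2], of p a b]
      \<open>p permutes {..<n}\<close> by (auto simp: sign_swap_id)
  show ?case unfolding 1 2 by simp
qed

lemma lie_deriv_sec_scale:
  assumes V: "V \<in> sections L" and f: "f \<in> smooth_fns" and \<eta>: "alternating_form \<eta>"
  shows "lie_deriv L (sec_scale L f V) \<eta> =
    form_add (form_scale f (lie_deriv L V \<eta>)) (wedge (d_rho L f) (int_prod V \<eta>))"
proof (intro ext)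
  fix vs x
  show "lie_deriv L (sec_scale L f V) \<eta> vs x =
    form_add (form_scale f (lie_deriv L V \<eta>)) (wedge (d_rho L f) (int_prod V \<eta>)) vs x"
  proof (cases "set vs \<subseteq> sections L")
    case False
    have "wedge (d_rho L f) (int_prod V \<eta>) vs = (\<lambda>x. 0)"
      by (rule wedge_vanishes[OF _ _ False])
         (auto simp: d_rho_def int_prod_def alternating_form_vanishes[OF \<eta>])
    thus ?thesis
      using False by (simp add: form_add_def form_scale_def lie_deriv_vanishes)
  next
    case True
    let ?n = "length vs"
    \<comment> \<open>The surplus left in slot \<open>i\<close> by the derivative of
      \<open>f\<close>; the sum of these terms has to be recognised as the wedge product.\<close>
    define g where "g i = anchor_deriv (vs ! i) f x * \<eta> (vs[i := V]) x" for i
    have "\<eta> (vs[i := bracket L (sec_scale L f V) (vs ! i)]) x =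
        f x * \<eta> (vs[i := bracket L V (vs ! i)]) x - g i" if i: "i < ?n" for i
    proof -
      note v = nth_section[OF True i]
      \<comment> \<open>The Leibniz rule concerns the second argument of the bracket, so the
        multiple of \<open>V\<close> is moved there and back by antisymmetry.\<close>
      have anti: "\<eta> (vs[i := bracket L s t]) x = - \<eta> (vs[i := bracket L t s]) x"
        if "s \<in> sections L" "t \<in> sections L" for s t
        by (rule additive_bracket_antisym(2)[where F = "\<lambda>s. \<eta> (vs[i := s]) x", OF _ that])
           (rule alternating_form_add[OF \<eta> True i])
      have "\<eta> (vs[i := bracket L (vs ! i) (sec_scale L f V)]) x =
          f x * \<eta> (vs[i := bracket L (vs ! i) V]) x + g i"
        by (simp add: g_def bracket_Leibniz V f v alternating_form_add[OF \<eta> True i]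
            alternating_form_scale[OF \<eta> True i] section_scale section_bracket anchor_deriv_smooth)
      thus ?thesis
        using anti[OF section_scale[OF V f] v] anti[OF v V] by simp
    qed
    hence "lie_deriv L (sec_scale L f V) \<eta> vs x = f x * lie_deriv L V \<eta> vs x + (\<Sum>i<?n. g i)"
      by (simp add: lie_deriv_sections[OF True] anchor_deriv_sec_scale[OF V] sum_subtractf
          sum_distrib_left right_diff_distrib)
    moreover have "wedge (d_rho L f) (int_prod V \<eta>) vs x = (\<Sum>i<?n. g i)"
    proof (cases "?n = 0")
      case True
      thus ?thesis by (simp add: wedge_def d_rho_def)
    next
      case False
      then obtain q where q: "?n = 1 + q" by (metis Suc_pred' neq0_conv plus_1_eq_Suc)
      let ?T = "\<lambda>p \<sigma>. of_int (sign \<sigma>) * d_rho L f (map (\<lambda>i. vs ! \<sigma> i) [0..<p]) x *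
          int_prod V \<eta> (map (\<lambda>i. vs ! \<sigma> i) [p..<?n]) x"
      have "wedge (d_rho L f) (int_prod V \<eta>) vs x =
          (\<Sum>p\<le>?n. \<Sum>\<sigma>\<in>perm_shuffles p (?n - p). ?T p \<sigma>)"
        by (simp add: wedge_def)
      \<comment> \<open>The form \<open>d_rho L f\<close> vanishes on lists of length other than 1,
        so a single splitting survives.\<close>
      also have "\<dots> = (\<Sum>p\<in>{1}. \<Sum>\<sigma>\<in>perm_shuffles p (?n - p). ?T p \<sigma>)"
        using q by (intro sum.mono_neutral_right) (auto simp: d_rho_def intro!: sum.neutral)
      also have "\<dots> = (\<Sum>\<sigma>\<in>perm_shuffles 1 q. ?T 1 \<sigma>)"
        by (simp add: q)
      also have "\<dots> = (\<Sum>\<sigma>\<in>perm_shuffles 1 q. g (\<sigma> 0))"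
      proof (rule sum.cong[OF refl])
        fix \<sigma> assume "\<sigma> \<in> perm_shuffles 1 q"
        hence \<sigma>: "\<sigma> permutes {..<1 + q}" by (simp add: perm_shuffles_def)
        have \<sigma>0: "\<sigma> 0 < ?n" using permutes_in_image[OF \<sigma>, of 0] q by simp
        \<comment> \<open>Placing \<open>V\<close> in slot \<open>\<sigma> 0\<close> and then
          permuting by \<open>\<sigma>\<close> brings it to the front, where the interior product
          expects it.\<close>
        have "V # map (\<lambda>i. vs ! \<sigma> i) [1..<?n] = map (\<lambda>i. vs[\<sigma> 0 := V] ! \<sigma> i) [0..<1 + q]"
          using shuffle_update_left[OF \<sigma> q, of 0 V] \<sigma>0 q
          by (simp add: upt_conv_Cons del: upt_Suc)
        hence "int_prod V \<eta> (map (\<lambda>i. vs ! \<sigma> i) [1..<?n]) x = of_int (sign \<sigma>) * \<eta> (vs[\<sigma> 0 := V]) x"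
          using alternating_form_permute[OF \<eta> \<sigma>, of "vs[\<sigma> 0 := V]" x] q
          by (simp add: int_prod_def update_sections True V)
        moreover have "d_rho L f (map (\<lambda>i. vs ! \<sigma> i) [0..<1]) x = anchor_deriv (vs ! \<sigma> 0) f x"
          using nth_section[OF True \<sigma>0] by (simp add: d_rho_def)
        \<comment> \<open>One sign comes from the wedge product and one from undoing the permutation
          of the arguments.\<close>
        moreover have "of_int (sign \<sigma>) * of_int (sign \<sigma>) = (1 :: real)"
          by (metis of_int_1 of_int_mult sign_idempotent)
        ultimately show "?T 1 \<sigma> = g (\<sigma> 0)"
          by (simp add: g_def algebra_simps)
      qed
      also have "\<dots> = (\<Sum>i<?n. g i)"
        using sum.reindex_bij_betw[OF shuffles_1_bij[of q], of g] q by simp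
      finally show ?thesis .
    qed
    ultimately show ?thesis
      by (simp add: form_add_def form_scale_def)
  qed
qed

end

theorem proposition4p1p4:
  fixes L :: "('m::{t2_space, second_countable_topology}, 'e) algebroid"
  assumes "lie_algebroid L"
  shows
    "(\<forall>V \<in> sections L. \<forall>f \<in> smooth_functions (base L).
        lie_deriv L V (d_rho L f) = d_rho L (lie_deriv L V (fun_form f) [])) \<and>
     (\<forall>V \<in> sections L. \<forall>W \<in> sections L. \<forall>\<eta> \<in> forms L.
        int_prod (bracket L V W) \<eta> =
          form_diff (lie_deriv L V (int_prod W \<eta>)) (int_prod W (lie_deriv L V \<eta>))) \<and>
     (\<forall>V \<in> sections L.
        (\<forall>p. \<forall>\<eta> \<in> forms_deg L p. lie_deriv L V \<eta> \<in> forms_deg L p) \<and>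
        (\<forall>\<eta> \<in> forms L. \<forall>\<zeta> \<in> forms L.
           lie_deriv L V (form_add \<eta> \<zeta>) = form_add (lie_deriv L V \<eta>) (lie_deriv L V \<zeta>)) \<and>
        (\<forall>c :: real. \<forall>\<eta> \<in> forms L.
           lie_deriv L V (form_scale (\<lambda>x. c) \<eta>) = form_scale (\<lambda>x. c) (lie_deriv L V \<eta>)) \<and>
        (\<forall>\<eta> \<in> forms L. \<forall>\<zeta> \<in> forms L.
           lie_deriv L V (wedge \<eta> \<zeta>) =
             form_add (wedge (lie_deriv L V \<eta>) \<zeta>) (wedge \<eta> (lie_deriv L V \<zeta>)))) \<and>
     (\<forall>V \<in> sections L. \<forall>W \<in> sections L. \<forall>\<eta> \<in> forms L.
        lie_deriv L (bracket L V W) \<eta> =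
          form_diff (lie_deriv L V (lie_deriv L W \<eta>)) (lie_deriv L W (lie_deriv L V \<eta>))) \<and>
     (\<forall>V \<in> sections L. \<forall>f \<in> smooth_functions (base L). \<forall>\<eta> \<in> forms L.
        lie_deriv L (sec_scale L f V) \<eta> =
          form_add (form_scale f (lie_deriv L V \<eta>)) (wedge (d_rho L f) (int_prod V \<eta>)))"
proof -
  interpret smooth_lie_algebroid L
    by unfold_locales (rule assms)
  show ?thesis
    \<comment> \<open>The identities were proved for alternating forms;
      \<open>forms_alternating\<close> transfers them to all elements of
      \<open>forms L\<close>.\<close>
    by (intro conjI ballI allI lie_deriv_d_rho int_prod_bracket lie_deriv_degree lie_deriv_form_add
        lie_deriv_form_scale lie_deriv_wedge lie_deriv_bracket lie_deriv_sec_scale forms_alternating)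
qed

end
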